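(* The problem 0-1-ILP over definable structures is undecidable: there is no algorithm which, given (finite presentations of) a definable set $X$ and a definable set $E$ of equations over $X$, decides whether $E$ has a solution, i.e. whether there is a valuation $v:X\to\{0,1\}$ that solves every equation in $E$.
   Context: Fix a countably infinite set $\mathbb{A}$ of atoms and an infinite set of atom variables. An expression is either a variable or a formal finite (possibly empty) union of set-builder expressions $\{e \mid x_1,\dots,x_k\in\mathbb{A},\ \varphi\}$ (with $k\ge 0$), where $e$ is an expression, the $x_i$ are bound variables, and $\varphi$ is a first-order formula over the atom variables with equality as the only relation symbol (interpreted in $(\mathbb{A},=)$). An expression $e$ with set of free variables $V$, together with a valuation $\sigma:V\to\mathbb{A}$, has a value $e[\sigma]$, defined in the obvious way by induction on $e$, which is an atom or a set; the sets arising this way are called definable. Pairs, tuples, integers, constants, disjoint unions etc. are encoded by standard set-theoretic means (e.g. $(x,y)=\{x,\{x,y\}\}$; integers are encoded by fixed distinct sets not involving atoms). A definable set is presented to an algorithm as a pair $(e,\sigma)$. For a definable set $X$ of variables, an equation over $X$ is a pair $(c,n)$, where $c:X\to\mathbb{Z}$ is a definable function and $n\in\mathbb{Z}$; it is intended to represent $\sum_{x\in X}c_x x=n$. An (arbitrary, not necessarily definable) valuation $v:X\to\{0,1\}$ solves the equation if (i) $v(x)$ and $c_x$ are simultaneously non-zero for only finitely many $x\in X$, and (ii) $\sum_{x\in X}c_x v(x)=n$. *)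

theory Defs
  imports Complex_Main "HOL-Library.Countable_Set_Type" "HOL-Library.Nat_Bijection"
begin

section \<open>Atoms, formulas and set-builder expressions\<close>

text \<open>Atoms and atom variables are represented by natural numbers. The order and arithmetic of the
  numbers are not accessible to formulas, whose only relation symbol is equality; they only serve to
  write atoms and variables down in the input of an algorithm.\<close>

type_synonym atom = nat
type_synonym avar = nat

datatype fm =
    TT
  | Eq avar avar
  | Neg fm
  | Conj fm fm
  | Disj fm fm
  | Ex avar fm
  | All avar fm

primrec sat :: "fm \<Rightarrow> (avar \<Rightarrow> atom) \<Rightarrow> bool" where
  "sat TT \<sigma> \<longleftrightarrow> True"
| "sat (Eq x y) \<sigma> \<longleftrightarrow> \<sigma> x = \<sigma> y"
| "sat (Neg \<phi>) \<sigma> \<longleftrightarrow> \<not> sat \<phi> \<sigma>"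
| "sat (Conj \<phi> \<psi>) \<sigma> \<longleftrightarrow> sat \<phi> \<sigma> \<and> sat \<psi> \<sigma>"
| "sat (Disj \<phi> \<psi>) \<sigma> \<longleftrightarrow> sat \<phi> \<sigma> \<or> sat \<psi> \<sigma>"
| "sat (Ex x \<phi>) \<sigma> \<longleftrightarrow> (\<exists>a. sat \<phi> (\<sigma>(x := a)))"
| "sat (All x \<phi>) \<sigma> \<longleftrightarrow> (\<forall>a. sat \<phi> (\<sigma>(x := a)))"

primrec fv_fm :: "fm \<Rightarrow> avar set" where
  "fv_fm TT = {}"
| "fv_fm (Eq x y) = {x, y}"
| "fv_fm (Neg \<phi>) = fv_fm \<phi>"
| "fv_fm (Conj \<phi> \<psi>) = fv_fm \<phi> \<union> fv_fm \<psi>"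
| "fv_fm (Disj \<phi> \<psi>) = fv_fm \<phi> \<union> fv_fm \<psi>"
| "fv_fm (Ex x \<phi>) = fv_fm \<phi> - {x}"
| "fv_fm (All x \<phi>) = fv_fm \<phi> - {x}"

text \<open>\<open>Compr e [x1,\<dots>,xk] \<phi>\<close> stands for \<open>{e | x1,\<dots>,xk \<in> \<A>, \<phi>}\<close>, and \<open>Union cs\<close> for the formal union of
  the set-builder expressions in the list \<open>cs\<close>.\<close>

datatype expr = Var avar | Union "compr list"
     and compr = Compr expr "avar list" fm

fun fv :: "expr \<Rightarrow> avar set" and fv_compr :: "compr \<Rightarrow> avar set" where
  "fv (Var x) = {x}"
| "fv (Union cs) = (\<Union>c\<in>set cs. fv_compr c)"
| "fv_compr (Compr e xs \<phi>) = (fv e \<union> fv_fm \<phi>) - set xs"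


section \<open>Values of expressions\<close>

text \<open>The hereditarily countable sets with atoms. They contain the values of all expressions,
  since there are only countably many atoms.\<close>

datatype hset = Atom atom | HSet "hset cset"

definition mk_set :: "hset set \<Rightarrow> hset" where
  "mk_set A = HSet (acset A)"

fun elts :: "hset \<Rightarrow> hset set" where
  "elts (Atom a) = {}"
| "elts (HSet A) = rcset A"

definition is_set :: "hset \<Rightarrow> bool" where
  "is_set s \<longleftrightarrow> (\<exists>A. s = HSet A)"

lemma elts_mk_set [simp]: "countable A \<Longrightarrow> elts (mk_set A) = A"
  by (simp add: mk_set_def acset_inverse)

lemma is_set_mk_set [simp]: "is_set (mk_set A)"
  by (simp add: is_set_def mk_set_def)

text \<open>Valuations are total here; only the values on the free variables matter (\<open>val_cong\<close> below).\<close>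

fun val :: "expr \<Rightarrow> (avar \<Rightarrow> atom) \<Rightarrow> hset"
and val_compr :: "compr \<Rightarrow> (avar \<Rightarrow> atom) \<Rightarrow> hset set" where
  "val (Var x) \<sigma> = Atom (\<sigma> x)"
| "val (Union cs) \<sigma> = mk_set (\<Union>c\<in>set cs. val_compr c \<sigma>)"
| "val_compr (Compr e xs \<phi>) \<sigma> = {val e \<tau> | \<tau>. (\<forall>y. y \<notin> set xs \<longrightarrow> \<tau> y = \<sigma> y) \<and> sat \<phi> \<tau>}"

definition definable :: "hset \<Rightarrow> bool" where
  "definable s \<longleftrightarrow> is_set s \<and> (\<exists>e \<sigma>. s = val e \<sigma>)"

lemma countable_variants: "countable {\<tau> :: avar \<Rightarrow> atom. \<forall>y. y \<notin> set xs \<longrightarrow> \<tau> y = \<sigma> y}"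
proof -
  have "inj_on (\<lambda>\<tau>. map \<tau> xs) {\<tau> :: avar \<Rightarrow> atom. \<forall>y. y \<notin> set xs \<longrightarrow> \<tau> y = \<sigma> y}"
  proof (rule inj_onI)
    fix \<tau> \<rho> :: "avar \<Rightarrow> atom"
    assume "\<tau> \<in> {\<tau>. \<forall>y. y \<notin> set xs \<longrightarrow> \<tau> y = \<sigma> y}" "\<rho> \<in> {\<tau>. \<forall>y. y \<notin> set xs \<longrightarrow> \<tau> y = \<sigma> y}"
      and "map \<tau> xs = map \<rho> xs"
    then have "\<tau> y = \<rho> y" for y by (cases "y \<in> set xs") auto
    then show "\<tau> = \<rho>" by blast
  qed
  then show ?thesis by (rule countableI')
qed

lemma countable_val_compr: "countable (val_compr c \<sigma>)"
proof (cases c)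
  case (Compr e xs \<phi>)
  have "val_compr c \<sigma> \<subseteq> (\<lambda>\<tau>. val e \<tau>) ` {\<tau>. \<forall>y. y \<notin> set xs \<longrightarrow> \<tau> y = \<sigma> y}"
    by (auto simp: Compr)
  then show ?thesis
    by (rule countable_subset) (rule countable_image[OF countable_variants])
qed

lemma elts_val_Union: "elts (val (Union cs) \<sigma>) = (\<Union>c\<in>set cs. val_compr c \<sigma>)"
  by (simp add: countable_val_compr countable_UN countable_finite)

lemma sat_cong: "(\<And>x. x \<in> fv_fm \<phi> \<Longrightarrow> \<sigma> x = \<tau> x) \<Longrightarrow> sat \<phi> \<sigma> = sat \<phi> \<tau>"
proof (induction \<phi> arbitrary: \<sigma> \<tau>)
  case (Neg \<phi>)
  then show ?case by (metis fv_fm.simps(3) sat.simps(3))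
next
  case (Conj \<phi> \<psi>)
  then show ?case by (metis UnCI fv_fm.simps(4) sat.simps(4))
next
  case (Disj \<phi> \<psi>)
  then show ?case by (metis UnCI fv_fm.simps(5) sat.simps(5))
next
  case (Ex x \<phi>)
  have "sat \<phi> (\<sigma>(x := a)) = sat \<phi> (\<tau>(x := a))" for a
    by (rule Ex.IH) (use Ex.prems in auto)
  then show ?case by simp
next
  case (All x \<phi>)
  have "sat \<phi> (\<sigma>(x := a)) = sat \<phi> (\<tau>(x := a))" for a
    by (rule All.IH) (use All.prems in auto)
  then show ?case by simp
qed simp_all

lemma val_cong:
  "(\<And>x. x \<in> fv e \<Longrightarrow> \<sigma> x = \<tau> x) \<Longrightarrow> val e \<sigma> = val e \<tau>"
  "(\<And>x. x \<in> fv_compr c \<Longrightarrow> \<sigma> x = \<tau> x) \<Longrightarrow> val_compr c \<sigma> = val_compr c \<tau>"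
proof (induction e and c arbitrary: \<sigma> \<tau> and \<sigma> \<tau>)
  case (Union cs)
  have "val_compr c \<sigma> = val_compr c \<tau>" if "c \<in> set cs" for c
    by (rule Union.IH[OF that]) (use Union.prems that in auto)
  then show ?case by simp
next
  case (Compr e xs \<phi>)
  have *: "val_compr (Compr e xs \<phi>) \<sigma> \<subseteq> val_compr (Compr e xs \<phi>) \<tau>"
    if eq: "\<And>x. x \<in> fv_compr (Compr e xs \<phi>) \<Longrightarrow> \<sigma> x = \<tau> x" for \<sigma> \<tau> :: "avar \<Rightarrow> atom"
  proof
    fix s assume "s \<in> val_compr (Compr e xs \<phi>) \<sigma>"
    then obtain \<rho> where \<rho>: "s = val e \<rho>" "\<forall>y. y \<notin> set xs \<longrightarrow> \<rho> y = \<sigma> y" "sat \<phi> \<rho>" by auto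
    define \<rho>' where "\<rho>' y = (if y \<in> set xs then \<rho> y else \<tau> y)" for y
    have "val e \<rho> = val e \<rho>'"
      by (rule Compr.IH) (use eq \<rho>(2) in \<open>auto simp: \<rho>'_def\<close>)
    moreover have "sat \<phi> \<rho> = sat \<phi> \<rho>'"
      by (rule sat_cong) (use eq \<rho>(2) in \<open>auto simp: \<rho>'_def\<close>)
    ultimately show "s \<in> val_compr (Compr e xs \<phi>) \<tau>"
      using \<rho> by (auto simp: \<rho>'_def intro!: exI[of _ \<rho>'])
  qed
  show ?case by (intro equalityI *) (use Compr.prems in auto)
qed simp


section \<open>Pairs, integers and equations\<close>

text \<open>The pair \<open>(x,y) = {x,{x,y}}\<close>; injectivity uses well-foundedness of membership.\<close>

definition hpair :: "hset \<Rightarrow> hset \<Rightarrow> hset" where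
  "hpair x y = mk_set {x, mk_set {x, y}}"

text \<open>Zermelo numerals, and an integer as the pair of its positive and its negative part.\<close>

primrec hnat :: "nat \<Rightarrow> hset" where
  "hnat 0 = mk_set {}"
| "hnat (Suc n) = mk_set {hnat n}"

definition hint :: "int \<Rightarrow> hset" where
  "hint i = hpair (hnat (nat i)) (hnat (nat (- i)))"

lemma mk_set_inj: "countable A \<Longrightarrow> countable B \<Longrightarrow> mk_set A = mk_set B \<longleftrightarrow> A = B"
  by (metis elts_mk_set)

lemma wf_elts: "wf {(x, y). x \<in> elts y}"
proof (rule wfUNIVI)
  fix P :: "hset \<Rightarrow> bool" and x
  assume step: "\<forall>x. (\<forall>y. (y, x) \<in> {(x, y). x \<in> elts y} \<longrightarrow> P y) \<longrightarrow> P x"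
  show "P x"
  proof (induction x)
    case (Atom a)
    then show ?case using step by auto
  next
    case (HSet A)
    then show ?case using step by (auto simp: cin.rep_eq)
  qed
qed

lemma hpair_inj [simp]: "hpair x y = hpair x' y' \<longleftrightarrow> x = x' \<and> y = y'"
proof
  assume eq: "hpair x y = hpair x' y'"
  then have *: "{x, mk_set {x, y}} = {x', mk_set {x', y'}}"
    by (simp add: hpair_def mk_set_inj)
  have "\<not> (x = mk_set {x', y'} \<and> x' = mk_set {x, y})"
  proof
    assume "x = mk_set {x', y'} \<and> x' = mk_set {x, y}"
    then have "x' \<in> elts x" "x \<in> elts x'" by (metis countable_insert countable_empty elts_mk_set insertI1)+
    then show False using wf_not_sym[OF wf_elts] by blast
  qed
  then have "x = x'" "mk_set {x, y} = mk_set {x', y'}" using * by (auto simp: doubleton_eq_iff)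
  then show "x = x' \<and> y = y'" by (auto simp: mk_set_inj doubleton_eq_iff)
qed simp

lemma hnat_inj [simp]: "hnat m = hnat n \<longleftrightarrow> m = n"
proof (induction m arbitrary: n)
  case 0
  show ?case by (cases n) (simp_all add: mk_set_inj)
next
  case (Suc m)
  then show ?case by (cases n) (simp_all add: mk_set_inj)
qed

lemma hint_inj [simp]: "hint i = hint j \<longleftrightarrow> i = j"
  by (auto simp: hint_def)

text \<open>\<open>hfun X c\<close> is the function \<open>X \<rightarrow> \<int>\<close> given by \<open>c\<close>, as a set of pairs.\<close>

definition hfun :: "hset \<Rightarrow> (hset \<Rightarrow> int) \<Rightarrow> hset" where
  "hfun X c = mk_set ((\<lambda>x. hpair x (hint (c x))) ` elts X)"

definition equation_over :: "hset \<Rightarrow> hset \<Rightarrow> bool" where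
  "equation_over X q \<longleftrightarrow> (\<exists>c n. q = hpair (hfun X c) (hint n) \<and> definable (hfun X c))"

definition solves :: "hset \<Rightarrow> (hset \<Rightarrow> int) \<Rightarrow> hset \<Rightarrow> bool" where
  "solves X v q \<longleftrightarrow> (\<exists>c n. q = hpair (hfun X c) (hint n) \<and>
     finite {x \<in> elts X. v x \<noteq> 0 \<and> c x \<noteq> 0} \<and>
     (\<Sum>x \<in> {x \<in> elts X. v x \<noteq> 0 \<and> c x \<noteq> 0}. c x * v x) = n)"

definition solvable01 :: "hset \<Rightarrow> hset \<Rightarrow> bool" where
  "solvable01 X E \<longleftrightarrow>
     (\<exists>v. (\<forall>x \<in> elts X. v x \<in> {0, 1}) \<and> (\<forall>q \<in> elts E. solves X v q))"


section \<open>Presentations and their encoding as numbers\<close>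

text \<open>A pair \<open>(e,\<sigma>)\<close> with \<open>\<sigma>\<close> a finite map, listed in any order, whose domain is the set of free
  variables of \<open>e\<close>.\<close>

type_synonym presentation = "expr \<times> (avar \<times> atom) list"

fun wf_pres :: "presentation \<Rightarrow> bool" where
  "wf_pres (e, \<sigma>) \<longleftrightarrow> distinct (map fst \<sigma>) \<and> fst ` set \<sigma> = fv e"

fun pres_val :: "presentation \<Rightarrow> hset" where
  "pres_val (e, \<sigma>) = val e (\<lambda>x. the (map_of \<sigma> x))"

definition ilp_instance :: "presentation \<Rightarrow> presentation \<Rightarrow> bool" where
  "ilp_instance P Q \<longleftrightarrow> wf_pres P \<and> wf_pres Q \<and>
     is_set (pres_val P) \<and> is_set (pres_val Q) \<and>
     (\<forall>q \<in> elts (pres_val Q). equation_over (pres_val P) q)"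

primrec enc_fm :: "fm \<Rightarrow> nat" where
  "enc_fm TT = prod_encode (0, 0)"
| "enc_fm (Eq x y) = prod_encode (1, prod_encode (x, y))"
| "enc_fm (Neg \<phi>) = prod_encode (2, enc_fm \<phi>)"
| "enc_fm (Conj \<phi> \<psi>) = prod_encode (3, prod_encode (enc_fm \<phi>, enc_fm \<psi>))"
| "enc_fm (Disj \<phi> \<psi>) = prod_encode (4, prod_encode (enc_fm \<phi>, enc_fm \<psi>))"
| "enc_fm (Ex x \<phi>) = prod_encode (5, prod_encode (x, enc_fm \<phi>))"
| "enc_fm (All x \<phi>) = prod_encode (6, prod_encode (x, enc_fm \<phi>))"

fun enc_expr :: "expr \<Rightarrow> nat" and enc_compr :: "compr \<Rightarrow> nat" where
  "enc_expr (Var x) = prod_encode (0, x)"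
| "enc_expr (Union cs) = prod_encode (1, list_encode (map enc_compr cs))"
| "enc_compr (Compr e xs \<phi>) =
     prod_encode (enc_expr e, prod_encode (list_encode xs, enc_fm \<phi>))"

fun enc_pres :: "presentation \<Rightarrow> nat" where
  "enc_pres (e, \<sigma>) = prod_encode (enc_expr e, list_encode (map prod_encode \<sigma>))"

definition enc_instance :: "presentation \<Rightarrow> presentation \<Rightarrow> nat" where
  "enc_instance P Q = prod_encode (enc_pres P, enc_pres Q)"


section \<open>Algorithms: partial recursive functions\<close>

text \<open>Programs for the partial (mu-)recursive functions, with a big-step semantics:
  \<open>computes p xs y\<close> means that \<open>p\<close> halts on the arguments \<open>xs\<close> with result \<open>y\<close>. A program applied
  to a number of arguments that does not fit its structure diverges.\<close>

datatype recf =
    Zero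
  | Succ
  | Proj nat
  | Comp recf "recf list"
  | PrimRec recf recf
  | Mu recf

inductive computes :: "recf \<Rightarrow> nat list \<Rightarrow> nat \<Rightarrow> bool" where
  Zero: "computes Zero xs 0"
| Succ: "computes Succ [x] (Suc x)"
| Proj: "i < length xs \<Longrightarrow> computes (Proj i) xs (xs ! i)"
| Comp: "list_all2 (\<lambda>g y. computes g xs y) gs ys \<Longrightarrow> computes f ys z \<Longrightarrow> computes (Comp f gs) xs z"
| PrimRec_0: "computes f xs y \<Longrightarrow> computes (PrimRec f g) (0 # xs) y"
| PrimRec_Suc: "computes (PrimRec f g) (n # xs) y \<Longrightarrow> computes g (n # y # xs) z \<Longrightarrow>
    computes (PrimRec f g) (Suc n # xs) z"
| Mu: "computes f (n # xs) 0 \<Longrightarrow> (\<And>m. m < n \<Longrightarrow> \<exists>y. computes f (m # xs) (Suc y)) \<Longrightarrow>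
    computes (Mu f) xs n"

lemma computes_det: "computes p xs y \<Longrightarrow> computes p xs z \<Longrightarrow> y = z"
proof (induction arbitrary: z rule: computes.induct)
  case (Zero xs)
  then show ?case by cases simp
next
  case (Succ x)
  then show ?case by cases simp
next
  case (Proj i xs)
  from Proj.prems show ?case by cases simp
next
  case (Comp xs gs ys f w)
  from Comp.prems show ?case
  proof cases
    case inv: (Comp ys')
    have len: "length ys = length ys'"
      using list_all2_lengthD[OF Comp.IH(1)] list_all2_lengthD[OF inv(1)] by simp
    have "ys ! i = ys' ! i" if "i < length ys" for i
      using list_all2_nthD2[OF Comp.IH(1) that] list_all2_nthD2[OF inv(1), of i] that len by simp
    then have "ys = ys'" using len by (rule nth_equalityI[rotated])
    then show ?thesis using Comp.IH(2) inv(2) by blast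
  qed
next
  case (PrimRec_0 f xs y g)
  from PrimRec_0.prems show ?case by cases (auto dest: PrimRec_0.IH)
next
  case (PrimRec_Suc f g n xs y w)
  from PrimRec_Suc.prems show ?case
  proof cases
    case inv: (PrimRec_Suc y')
    then show ?thesis using PrimRec_Suc.IH by blast
  qed
next
  case (Mu f n xs)
  from Mu.prems show ?case
  proof cases
    case inv: Mu
    show ?thesis
    proof (rule linorder_cases[of n z])
      assume "n < z"
      then obtain y where "computes f (n # xs) (Suc y)" using inv(2) by blast
      then show ?thesis using Mu.IH(1) by fastforce
    next
      assume "z < n"
      then obtain y where "\<And>w. computes f (z # xs) w \<Longrightarrow> Suc y = w" using Mu.IH(2) by blast
      then show ?thesis using inv(1) by fastforce
    qed
  qed
qed

text \<open>A decision procedure has to halt with answer 1 (yes) or 0 (no) on every instance; nothing is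
  required of its behaviour on numbers that do not encode an instance.\<close>

definition decides :: "recf \<Rightarrow> (presentation \<Rightarrow> presentation \<Rightarrow> bool) \<Rightarrow>
    (presentation \<Rightarrow> presentation \<Rightarrow> bool) \<Rightarrow> bool" where
  "decides p inst yes \<longleftrightarrow> (\<forall>P Q. inst P Q \<longrightarrow>
     computes p [enc_instance P Q] (if yes P Q then 1 else 0))"

end

theory Submission
  imports Defs "HOL-Library.Indicator_Function"
begin

text \<open>An arbitrary 0-1 valuation of unknowns indexed by tuples of atoms is a tuple of arbitrary relations
  on the atoms, and equations with coefficients 0 and 1 can express that a relation is the graph of
  a function and that a universally quantified clause holds. So a definable system can ask for a
  zero, a successor function and relations that are closed under the rules of an interpreter for the
  recursive functions. The interpreter is fixed; the only part that varies is the equation stating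
  that an initial segment of the numerals has exactly \<open>n + 1\<close> elements, which singles out the
  numeral \<open>n\<close> by means of one integer. A last clause forbids that the program with code \<open>n\<close> returns 1
  on input \<open>n\<close>. Every solution contains the least model of the rules, and the least model yields a
  solution unless it violates the last clause, so the system is solvable iff the program does not
  return 1 on its own code. As the encoding of the system is computable from \<open>n\<close>, a decision
  procedure composed with it would return 1 on its own code iff it does not.\<close>

section \<open>Systems of counting constraints as definable sets of equations\<close>

lemma countable_elts [simp]: "countable (elts s)"
  by (cases s) auto

abbreviation elem :: "expr \<Rightarrow> compr" where
  "elem e \<equiv> Compr e [] TT"

lemma val_compr_elem [simp]: "val_compr (elem e) \<sigma> = {val e \<sigma>}"
proof -
  have "(\<forall>y. \<tau> y = \<sigma> y) \<longleftrightarrow> \<tau> = \<sigma>" for \<tau>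
    by auto
  then show ?thesis by simp
qed

declare val_compr.simps [simp del]

definition pair_e :: "expr \<Rightarrow> expr \<Rightarrow> expr" where
  "pair_e x y = Union [elem x, elem (Union [elem x, elem y])]"

primrec hnat_e :: "nat \<Rightarrow> expr" where
  "hnat_e 0 = Union []"
| "hnat_e (Suc n) = Union [elem (hnat_e n)]"

text \<open>Coefficients are 0 or 1 and right-hand sides are cardinalities, so the negative part in
  \<open>hint\<close> is always the numeral 0.\<close>

definition int_e :: "nat \<Rightarrow> expr" where
  "int_e n = pair_e (hnat_e n) (hnat_e 0)"

primrec tup :: "atom list \<Rightarrow> hset" where
  "tup [] = mk_set {}"
| "tup (a # us) = hpair (Atom a) (tup us)"

primrec tup_e :: "avar list \<Rightarrow> expr" where
  "tup_e [] = Union []"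
| "tup_e (x # xs) = pair_e (Var x) (tup_e xs)"

lemma val_pair_e [simp]: "val (pair_e x y) \<sigma> = hpair (val x \<sigma>) (val y \<sigma>)"
  by (simp add: pair_e_def hpair_def insert_commute)

lemma val_hnat_e [simp]: "val (hnat_e n) \<sigma> = hnat n"
  by (induction n) simp_all

lemma val_int_e [simp]: "val (int_e n) \<sigma> = hint (int n)"
  unfolding int_e_def hint_def val_pair_e val_hnat_e by simp

lemma val_tup_e [simp]: "val (tup_e xs) \<sigma> = tup (map \<sigma> xs)"
  by (induction xs) simp_all

lemma fv_pair_e [simp]: "fv (pair_e x y) = fv x \<union> fv y"
  by (auto simp: pair_e_def)

lemma fv_hnat_e [simp]: "fv (hnat_e n) = {}"
  by (induction n) simp_all

lemma fv_int_e [simp]: "fv (int_e n) = {}"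
  by (simp add: int_e_def del: hnat_e.simps)

lemma fv_tup_e [simp]: "fv (tup_e xs) = set xs"
  by (induction xs) simp_all

lemma hpair_neq_empty [simp]: "hpair x y \<noteq> mk_set {}" "mk_set {} \<noteq> hpair x y"
  by (simp_all add: hpair_def mk_set_inj)

lemma tup_inj [simp]: "tup us = tup bs \<longleftrightarrow> us = bs"
proof (induction us arbitrary: bs)
  case Nil
  show ?case by (cases bs) simp_all
next
  case (Cons a us)
  then show ?case by (cases bs) simp_all
qed

text \<open>The name, inside the set \<open>X\<close>, of the unknown with tag \<open>i\<close> and
  index tuple \<open>us\<close>. The tag becomes a numeral, hence involves no atoms, and the tuple
  carries all the dependence on atoms.\<close>

fun el :: "'i::countable \<times> atom list \<Rightarrow> hset" where
  "el (i, us) = hpair (hnat (to_nat i)) (tup us)"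

lemma inj_el: "inj el"
  by (rule injI) (auto simp del: hnat.simps)

definition agree_off :: "avar list \<Rightarrow> (avar \<Rightarrow> atom) \<Rightarrow> (avar \<Rightarrow> atom) \<Rightarrow> bool" where
  "agree_off xs \<sigma> \<tau> \<longleftrightarrow> (\<forall>y. y \<notin> set xs \<longrightarrow> \<tau> y = \<sigma> y)"

lemma val_compr_Compr: "val_compr (Compr e xs \<phi>) \<sigma> = val e ` {\<tau>. agree_off xs \<sigma> \<tau> \<and> sat \<phi> \<tau>}"
  by (auto simp: val_compr.simps agree_off_def)

lemma ex_agree_off_upt:
  assumes "length us = l"
  obtains \<tau> where "agree_off [k..<k + l] \<sigma> \<tau>" "map \<tau> [k..<k + l] = us"
proof
  let ?\<tau> = "\<lambda>y. if k \<le> y \<and> y < k + l then us ! (y - k) else \<sigma> y"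
  show "agree_off [k..<k + l] \<sigma> ?\<tau>"
    by (auto simp: agree_off_def)
  show "map ?\<tau> [k..<k + l] = us"
    using assms by (intro nth_equalityI) auto
qed

definition unknown_e :: "avar \<Rightarrow> 'i::countable \<Rightarrow> nat \<Rightarrow> expr" where
  "unknown_e k i l = pair_e (hnat_e (to_nat i)) (tup_e [k..<k + l])"

lemma val_unknown_e [simp]: "val (unknown_e k i l) \<sigma> = el (i, map \<sigma> [k..<k + l])"
  by (simp add: unknown_e_def)

lemma fv_unknown_e [simp]: "fv (unknown_e k i l) = {k..<k + l}"
  by (simp add: unknown_e_def)

definition unknowns_e :: "('i::countable \<times> nat) list \<Rightarrow> expr" where
  "unknowns_e ids = Union (map (\<lambda>(i, l). Compr (unknown_e 0 i l) [0..<l] TT) ids)"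

lemma elts_unknowns_e:
  "elts (val (unknowns_e ids) \<sigma>) = el ` {(i, us). (i, length us) \<in> set ids}"
proof -
  have "el (i, us) \<in> val_compr (Compr (unknown_e 0 i (length us)) [0..<length us] TT) \<sigma>"
    for i :: 'a and us
  proof -
    obtain \<tau> where "agree_off [0..<0 + length us] \<sigma> \<tau>" "map \<tau> [0..<0 + length us] = us"
      using ex_agree_off_upt[OF refl] .
    then show ?thesis
      by (auto simp: val_compr_Compr simp del: el.simps intro!: image_eqI[of _ _ \<tau>])
  qed
  then show ?thesis
    unfolding unknowns_e_def elts_val_Union
    by (fastforce simp: val_compr_Compr simp del: el.simps)
qed

lemma fv_unknowns_e [simp]: "fv (unknowns_e ids) = {}"
  by (auto simp: unknowns_e_def)

text \<open>A constraint \<open>(ts, ys, n)\<close> demands, for every valuation of the variables outside \<open>ys\<close>, that exactly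
  \<open>n\<close> of the unknowns obtained from the terms \<open>ts\<close> by varying \<open>ys\<close> have the value 1.\<close>

type_synonym 'i constraint = "('i \<times> avar list) list \<times> avar list \<times> nat"

definition instances :: "('i \<times> avar list) list \<Rightarrow> avar list \<Rightarrow> (avar \<Rightarrow> atom) \<Rightarrow> ('i \<times> atom list) set" where
  "instances ts ys \<rho> = {(i, map \<tau> w) | i w \<tau>. (i, w) \<in> set ts \<and> agree_off ys \<rho> \<tau>}"

text \<open>\<open>W\<close> stands for the unknowns of value 1. Finiteness is stated separately
  because \<open>card\<close> is 0 on infinite sets, whereas a valuation with infinitely many
  nonzero terms does not solve an equation.\<close>

definition holds :: "('i \<times> atom list) set \<Rightarrow> 'i constraint \<Rightarrow> bool" where
  "holds W = (\<lambda>(ts, ys, n). \<forall>\<rho>. finite (W \<inter> instances ts ys \<rho>) \<and> card (W \<inter> instances ts ys \<rho>) = n)"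

text \<open>Leaves the variables from \<open>k\<close> on free to hold the index tuple of an
  arbitrary unknown.\<close>

definition vars_below :: "avar \<Rightarrow> 'i constraint \<Rightarrow> bool" where
  "vars_below k = (\<lambda>(ts, ys, n). (\<forall>(i, w) \<in> set ts. set w \<subseteq> {..<k}) \<and> set ys \<subseteq> {..<k})"

text \<open>The tags and arities of the unknowns that occur. The counts are ignored, so systems that
  differ only in a count share one set of unknowns.\<close>

definition slots :: "'i constraint list \<Rightarrow> ('i \<times> nat) list" where
  "slots cs = concat (map (\<lambda>(ts, ys, n). map (\<lambda>(i, w). (i, length w)) ts) cs)"

section \<open>Formulas for membership among the counted unknowns\<close>

definition exs :: "avar list \<Rightarrow> fm \<Rightarrow> fm" where
  "exs ys \<phi> = foldr Ex ys \<phi>"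

definition conjs :: "fm list \<Rightarrow> fm" where
  "conjs \<phi>s = foldr Conj \<phi>s TT"

definition disjs :: "fm list \<Rightarrow> fm" where
  "disjs \<phi>s = foldr Disj \<phi>s (Neg TT)"

lemma sat_exs: "sat (exs ys \<phi>) \<sigma> \<longleftrightarrow> (\<exists>\<tau>. agree_off ys \<sigma> \<tau> \<and> sat \<phi> \<tau>)"
proof (induction ys arbitrary: \<sigma>)
  case Nil
  have "agree_off [] \<sigma> \<tau> \<longleftrightarrow> \<tau> = \<sigma>" for \<tau>
    by (auto simp: agree_off_def)
  then show ?case by (simp add: exs_def)
next
  case (Cons y ys)
  have "(\<exists>a. agree_off ys (\<sigma>(y := a)) \<tau>) \<longleftrightarrow> agree_off (y # ys) \<sigma> \<tau>" for \<tau>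
  proof
    assume "agree_off (y # ys) \<sigma> \<tau>"
    then have "agree_off ys (\<sigma>(y := \<tau> y)) \<tau>" by (simp add: agree_off_def)
    then show "\<exists>a. agree_off ys (\<sigma>(y := a)) \<tau>" ..
  qed (auto simp: agree_off_def split: if_splits)
  moreover have "sat (exs (y # ys) \<phi>) \<sigma> \<longleftrightarrow> (\<exists>a. sat (exs ys \<phi>) (\<sigma>(y := a)))"
    by (simp add: exs_def)
  ultimately show ?case unfolding Cons.IH by blast
qed

lemma sat_conjs [simp]: "sat (conjs \<phi>s) \<sigma> \<longleftrightarrow> (\<forall>\<phi>\<in>set \<phi>s. sat \<phi> \<sigma>)"
  by (induction \<phi>s) (simp_all add: conjs_def)

lemma sat_disjs [simp]: "sat (disjs \<phi>s) \<sigma> \<longleftrightarrow> (\<exists>\<phi>\<in>set \<phi>s. sat \<phi> \<sigma>)"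
  by (induction \<phi>s) (simp_all add: disjs_def)

lemma fv_fm_exs [simp]: "fv_fm (exs ys \<phi>) = fv_fm \<phi> - set ys"
  by (induction ys) (auto simp: exs_def)

lemma fv_fm_conjs [simp]: "fv_fm (conjs \<phi>s) = (\<Union>\<phi>\<in>set \<phi>s. fv_fm \<phi>)"
  by (induction \<phi>s) (simp_all add: conjs_def)

lemma fv_fm_disjs [simp]: "fv_fm (disjs \<phi>s) = (\<Union>\<phi>\<in>set \<phi>s. fv_fm \<phi>)"
  by (induction \<phi>s) (simp_all add: disjs_def)

text \<open>States that the unknown with tag \<open>i\<close> and the tuple of the variables \<open>k, \<dots>, k + l - 1\<close> is one of
  those counted by a constraint whose own variables are below \<open>k\<close>.\<close>

definition member_fm :: "avar \<Rightarrow> ('i \<times> avar list) list \<Rightarrow> avar list \<Rightarrow> 'i \<Rightarrow> nat \<Rightarrow> fm" where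
  "member_fm k ts ys i l = disjs (map (\<lambda>(i, w). exs ys (conjs (map2 Eq [k..<k + l] w)))
     (filter (\<lambda>(i', w). i' = i \<and> length w = l) ts))"

lemma sat_conjs_Eq:
  assumes "length xs = length w"
  shows "sat (conjs (map2 Eq xs w)) \<tau> \<longleftrightarrow> map \<tau> xs = map \<tau> w"
  using assms by (induction xs w rule: list_induct2) (auto simp: conjs_def)

text \<open>The formula requantifies \<open>ys\<close> and compares the resulting terms with the
  tuple held by the variables from \<open>k\<close> on. As \<open>ys\<close> lies below
  \<open>k\<close>, requantification does not disturb that tuple.\<close>

lemma sat_member_fm:
  assumes "vars_below k (ts, ys, n)"
  shows "sat (member_fm k ts ys i l) \<tau> \<longleftrightarrow> (i, map \<tau> [k..<k + l]) \<in> instances ts ys \<tau>"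
proof -
  have fresh: "map \<tau>' [k..<k + l] = map \<tau> [k..<k + l]" if "agree_off ys \<tau> \<tau>'" for \<tau>'
  proof -
    have "y \<notin> set ys" if "k \<le> y" for y
      using assms that by (auto simp: vars_below_def)
    then show ?thesis using that by (auto simp: agree_off_def)
  qed
  have *: "sat (exs ys (conjs (map2 Eq [k..<k + l] w))) \<tau> \<longleftrightarrow>
      (\<exists>\<tau>'. agree_off ys \<tau> \<tau>' \<and> map \<tau> [k..<k + l] = map \<tau>' w)" if "length w = l" for w
  proof -
    have "length [k..<k + l] = length w" using that by simp
    then show ?thesis unfolding sat_exs using fresh by (metis sat_conjs_Eq)
  qed
  have "sat (member_fm k ts ys i l) \<tau> \<longleftrightarrow> (\<exists>w. (i, w) \<in> set ts \<and> length w = l \<and>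
      sat (exs ys (conjs (map2 Eq [k..<k + l] w))) \<tau>)"
    by (auto simp: member_fm_def)
  also have "\<dots> \<longleftrightarrow> (\<exists>w \<tau>'. (i, w) \<in> set ts \<and> agree_off ys \<tau> \<tau>' \<and> map \<tau> [k..<k + l] = map \<tau>' w)"
    using * by (metis diff_add_inverse length_map length_upt)
  finally show ?thesis by (auto simp: instances_def)
qed

lemma instances_cong:
  assumes "vars_below k (ts, ys, n)" and "\<And>x. x < k \<Longrightarrow> \<sigma> x = \<tau> x"
  shows "instances ts ys \<sigma> = instances ts ys \<tau>"
proof -
  have sub: "instances ts ys \<sigma> \<subseteq> instances ts ys \<tau>" if "\<And>x. x < k \<Longrightarrow> \<sigma> x = \<tau> x" for \<sigma> \<tau>
  proof
    fix x assume "x \<in> instances ts ys \<sigma>"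
    then obtain i w \<rho> where x: "x = (i, map \<rho> w)" "(i, w) \<in> set ts" "agree_off ys \<sigma> \<rho>"
      by (auto simp: instances_def)
    define \<rho>' where "\<rho>' y = (if y < k then \<rho> y else \<tau> y)" for y
    have "set w \<subseteq> {..<k}" using assms(1) x(2) by (auto simp: vars_below_def)
    then have "map \<rho> w = map \<rho>' w" by (auto simp: \<rho>'_def)
    moreover have "agree_off ys \<tau> \<rho>'" using x(3) that by (auto simp: agree_off_def \<rho>'_def)
    ultimately show "x \<in> instances ts ys \<tau>" using x unfolding instances_def by blast
  qed
  show ?thesis using sub[of \<sigma> \<tau>] sub[of \<tau> \<sigma>] assms(2) by auto
qed

text \<open>The graph of a coefficient function, assembled for each slot from the fibres over 1 and
  0. The variables below \<open>k\<close> remain free and act as parameters of the equation.\<close>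

definition indicator_e :: "avar \<Rightarrow> ('i::countable \<times> nat) list \<Rightarrow> ('i \<times> avar list) list \<Rightarrow> avar list \<Rightarrow> expr" where
  "indicator_e k ids ts ys = Union (concat (map (\<lambda>(i, l).
     [Compr (pair_e (unknown_e k i l) (int_e 1)) [k..<k + l] (member_fm k ts ys i l),
      Compr (pair_e (unknown_e k i l) (int_e 0)) [k..<k + l] (Neg (member_fm k ts ys i l))]) ids))"

text \<open>The fresh variables from \<open>k\<close> on range over all index tuples and do not
  influence \<open>instances ts ys\<close>. The valuation \<open>\<sigma>\<close> is arbitrary
  because \<open>unknowns_e ids\<close> is closed.\<close>

lemma val_indicator_e:
  assumes "vars_below k (ts, ys, n)"
  shows "val (indicator_e k ids ts ys) \<rho> =
    hfun (val (unknowns_e ids) \<sigma>) (indicator (el ` instances ts ys \<rho>))"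
    (is "_ = hfun _ ?c")
proof -
  have mem: "\<And>i us. el (i, us) \<in> el ` instances ts ys \<rho> \<longleftrightarrow> (i, us) \<in> instances ts ys \<rho>"
    using inj_el by (metis inj_image_mem_iff)
  let ?F = "\<lambda>i l n \<phi>. val_compr (Compr (pair_e (unknown_e k i l) (int_e n)) [k..<k + l] \<phi>) \<rho>"
  have inst: "instances ts ys \<tau> = instances ts ys \<rho>" if "agree_off [k..<k + l] \<rho> \<tau>" for l \<tau>
    by (rule instances_cong[OF assms]) (use that in \<open>auto simp: agree_off_def\<close>)
  have 1: "?F i l 1 (member_fm k ts ys i l) \<union> ?F i l 0 (Neg (member_fm k ts ys i l)) =
      {hpair (el (i, us)) (hint (?c (el (i, us)))) | us. length us = l}" (is "?L = ?R") for i l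
  proof
    show "?L \<subseteq> ?R"
      by (auto simp: val_compr_Compr sat_member_fm[OF assms] inst indicator_def mem
          simp del: el.simps intro!: exI[of _ "map _ [k..<k + l]"])
    show "?R \<subseteq> ?L"
    proof
      fix x assume "x \<in> ?R"
      then obtain us where us: "length us = l" "x = hpair (el (i, us)) (hint (?c (el (i, us))))"
        by auto
      obtain \<tau> where \<tau>: "agree_off [k..<k + l] \<rho> \<tau>" "map \<tau> [k..<k + l] = us"
        using ex_agree_off_upt[OF us(1)] .
      show "x \<in> ?L"
        using \<tau> inst[OF \<tau>(1)]
        by (cases "(i, us) \<in> instances ts ys \<rho>")
          (auto simp: us val_compr_Compr sat_member_fm[OF assms] indicator_def mem
            simp del: el.simps intro!: image_eqI[of _ _ \<tau>])
    qed
  qed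
  have "(\<Union>c \<in> set (concat (map (\<lambda>(i, l).
     [Compr (pair_e (unknown_e k i l) (int_e 1)) [k..<k + l] (member_fm k ts ys i l),
      Compr (pair_e (unknown_e k i l) (int_e 0)) [k..<k + l] (Neg (member_fm k ts ys i l))]) ids)). val_compr c \<rho>)
     = (\<Union>(i, l) \<in> set ids. ?F i l 1 (member_fm k ts ys i l) \<union> ?F i l 0 (Neg (member_fm k ts ys i l)))"
    by auto
  also have "\<dots> = (\<lambda>x. hpair x (hint (?c x))) ` elts (val (unknowns_e ids) \<sigma>)"
    unfolding 1 elts_unknowns_e by (auto simp del: el.simps)
  finally show ?thesis by (simp add: indicator_e_def hfun_def)
qed

text \<open>Binding all parameters yields one equation per valuation, which renders the universal
  quantifier in \<open>holds\<close>.\<close>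

definition equations_c :: "avar \<Rightarrow> ('i::countable \<times> nat) list \<Rightarrow> 'i constraint \<Rightarrow> compr" where
  "equations_c k ids = (\<lambda>(ts, ys, n). Compr (pair_e (indicator_e k ids ts ys) (int_e n)) [0..<k] TT)"

lemma val_equations_c:
  assumes "vars_below k (ts, ys, n)"
  shows "val_compr (equations_c k ids (ts, ys, n)) \<sigma> =
    range (\<lambda>\<rho>. hpair (hfun (val (unknowns_e ids) \<sigma>) (indicator (el ` instances ts ys \<rho>))) (hint (int n)))"
    (is "_ = range ?q")
proof -
  have "val_compr (equations_c k ids (ts, ys, n)) \<sigma> = ?q ` {\<rho>. agree_off [0..<k] \<sigma> \<rho>}"
    by (simp add: equations_c_def val_compr_Compr val_indicator_e[OF assms, of _ _ \<sigma>])
  also have "\<dots> = range ?q"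
  proof -
    have "?q \<rho> \<in> ?q ` {\<rho>. agree_off [0..<k] \<sigma> \<rho>}" for \<rho>
    proof
      \<comment> \<open>The binder leaves \<open>\<sigma>\<close> in force from \<open>k\<close> on;
        overwriting \<open>\<rho>\<close> there changes no instance.\<close>
      show "?q \<rho> = ?q (\<lambda>y. if y < k then \<rho> y else \<sigma> y)"
        using instances_cong[OF assms, of \<rho> "\<lambda>y. if y < k then \<rho> y else \<sigma> y"] by simp
    qed (auto simp: agree_off_def)
    then show ?thesis by blast
  qed
  finally show ?thesis .
qed

lemma fv_equations_c:
  assumes "vars_below k s"
  shows "fv_compr (equations_c k ids s) = {}"
proof -
  obtain ts ys n where s: "s = (ts, ys, n)" by (cases s)
  have 1: "fv_fm (conjs (map2 Eq [k..<k + length w] w)) \<subseteq> {k..<k + length w} \<union> {..<k}" if "(i, w) \<in> set ts" for i w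
    using assms that by (fastforce simp: s vars_below_def dest: set_zip_leftD set_zip_rightD)
  have "fv_fm (member_fm k ts ys i l) \<subseteq> {k..<k + l} \<union> {..<k}" for i l
  proof
    fix x assume "x \<in> fv_fm (member_fm k ts ys i l)"
    then have "\<exists>w. (i, w) \<in> set ts \<and> length w = l \<and> x \<in> fv_fm (conjs (map2 Eq [k..<k + length w] w))"
      by (fastforce simp: member_fm_def simp del: fv_fm_conjs)
    then show "x \<in> {k..<k + l} \<union> {..<k}" using 1 by blast
  qed
  then have "fv_fm (member_fm k ts ys i l) - {k..<k + l} \<subseteq> {..<k}" for i l by blast
  then have "fv (indicator_e k ids ts ys) \<subseteq> {..<k}"
    unfolding indicator_e_def by (auto simp: subset_iff)
  then show ?thesis by (auto simp: s equations_c_def)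
qed

definition system_e :: "avar \<Rightarrow> 'i::countable constraint list \<Rightarrow> expr" where
  "system_e k cs = Union (map (equations_c k (slots cs)) cs)"

section \<open>Solutions of the system\<close>

lemma hfun_inj: "hfun X c = hfun X c' \<Longrightarrow> x \<in> elts X \<Longrightarrow> c x = c' x"
  proof -
  assume "hfun X c = hfun X c'" and x: "x \<in> elts X"
  then have "(\<lambda>x. hpair x (hint (c x))) ` elts X = (\<lambda>x. hpair x (hint (c' x))) ` elts X"
    by (simp add: hfun_def mk_set_inj)
  with x have "hpair x (hint (c x)) \<in> (\<lambda>x. hpair x (hint (c' x))) ` elts X" by auto
  then show "c x = c' x" by auto
qed

text \<open>For a 0-1 valuation the sum counts the elements of \<open>A\<close> with value 1. A
  graph determines its coefficient function on \<open>X\<close> only, so the auxiliary facts concern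
  every \<open>c\<close> that agrees with the indicator there.\<close>

lemma solves_indicator_iff:
  assumes "A \<subseteq> elts X" and "\<forall>x\<in>elts X. v x \<in> {0, 1}"
  shows "solves X v (hpair (hfun X (indicator A)) (hint (int n))) \<longleftrightarrow>
    finite {x\<in>A. v x = 1} \<and> card {x\<in>A. v x = 1} = n"
proof -
  have *: "{x \<in> elts X. v x \<noteq> 0 \<and> c x \<noteq> 0} = {x\<in>A. v x = 1}"
    "(\<Sum>x \<in> {x\<in>A. v x = 1}. c x * v x) = int (card {x\<in>A. v x = 1})"
    if c: "\<And>x. x \<in> elts X \<Longrightarrow> c x = indicator A x" for c :: "hset \<Rightarrow> int"
  proof -
    show "{x \<in> elts X. v x \<noteq> 0 \<and> c x \<noteq> 0} = {x\<in>A. v x = 1}"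
      using assms by (auto simp: c indicator_def)
    have "(\<Sum>x \<in> {x\<in>A. v x = 1}. c x * v x) = (\<Sum>x \<in> {x\<in>A. v x = 1}. 1)"
      by (rule sum.cong) (use assms in \<open>auto simp: c\<close>)
    then show "(\<Sum>x \<in> {x\<in>A. v x = 1}. c x * v x) = int (card {x\<in>A. v x = 1})"
      by simp
  qed
  show ?thesis
  proof
    assume "solves X v (hpair (hfun X (indicator A)) (hint (int n)))"
    then obtain c where c: "hfun X (indicator A) = hfun X c"
      and "finite {x \<in> elts X. v x \<noteq> 0 \<and> c x \<noteq> 0}"
      and "(\<Sum>x \<in> {x \<in> elts X. v x \<noteq> 0 \<and> c x \<noteq> 0}. c x * v x) = int n"
      by (auto simp: solves_def)
    with *[of c] hfun_inj[OF c] show "finite {x\<in>A. v x = 1} \<and> card {x\<in>A. v x = 1} = n"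
      by auto
  next
    assume "finite {x\<in>A. v x = 1} \<and> card {x\<in>A. v x = 1} = n"
    then show "solves X v (hpair (hfun X (indicator A)) (hint (int n)))"
      unfolding solves_def using *[of "indicator A"] by (intro exI[of _ "indicator A"]) auto
  qed
qed

lemma elts_system_e:
  assumes "\<forall>s\<in>set cs. vars_below k s"
  shows "elts (val (system_e k cs) \<sigma>) = (\<Union>(ts, ys, n)\<in>set cs. range (\<lambda>\<rho>.
    hpair (hfun (val (unknowns_e (slots cs)) \<sigma>) (indicator (el ` instances ts ys \<rho>))) (hint (int n))))"
proof -
  have "val_compr (equations_c k (slots cs) s) \<sigma> = (case s of (ts, ys, n) \<Rightarrow> range (\<lambda>\<rho>.
    hpair (hfun (val (unknowns_e (slots cs)) \<sigma>) (indicator (el ` instances ts ys \<rho>))) (hint (int n))))"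
    if "s \<in> set cs" for s
  proof (cases s)
    case (fields ts ys n)
    then have "vars_below k (ts, ys, n)" using assms that by blast
    from val_equations_c[OF this] show ?thesis unfolding fields by simp
  qed
  then show ?thesis unfolding system_e_def elts_val_Union by auto
qed

lemma instances_subset_slots:
  assumes "(ts, ys, n) \<in> set cs"
  shows "el ` instances ts ys \<rho> \<subseteq> elts (val (unknowns_e (slots cs)) \<sigma>)"
  unfolding elts_unknowns_e using assms
  by (force simp: instances_def slots_def simp del: el.simps)

lemma solvable01_system_e:
  assumes "\<forall>s\<in>set cs. vars_below k s"
  shows "solvable01 (val (unknowns_e (slots cs)) \<sigma>) (val (system_e k cs) \<sigma>) \<longleftrightarrow>
    (\<exists>W. \<forall>s\<in>set cs. holds W s)"
proof -
  let ?X = "val (unknowns_e (slots cs)) \<sigma>" and ?E = "val (system_e k cs) \<sigma>"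
  have solves: "(\<forall>q\<in>elts ?E. solves ?X v q) \<longleftrightarrow> (\<forall>s\<in>set cs. holds {p. v (el p) = 1} s)"
    if "\<forall>x\<in>elts ?X. v x \<in> {0, 1}" for v
  proof -
    have *: "{x \<in> el ` I. v x = 1} = el ` ({p. v (el p) = 1} \<inter> I)" for I :: "('a \<times> atom list) set"
      by auto
    have inj: "inj_on el I" for I :: "('a \<times> atom list) set"
      using inj_el inj_on_subset by blast
    show ?thesis
      unfolding elts_system_e[OF assms] holds_def
      by (fastforce simp: solves_indicator_iff[OF instances_subset_slots that] *
          finite_image_iff[OF inj] card_image[OF inj] simp del: el.simps)
  qed
  show ?thesis
  proof
    assume "solvable01 ?X ?E"
    then show "\<exists>W. \<forall>s\<in>set cs. holds W s" using solves unfolding solvable01_def by blast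
  next
    assume "\<exists>W. \<forall>s\<in>set cs. holds W s"
    then obtain W where W: "\<forall>s\<in>set cs. holds W s" ..
    define v :: "hset \<Rightarrow> int" where "v = indicator (el ` W)"
    have "{p. v (el p) = 1} = W"
      using inj_image_mem_iff[OF inj_el] by (auto simp: v_def indicator_eq_1_iff simp del: el.simps)
    moreover have v: "\<forall>x\<in>elts ?X. v x \<in> {0, 1}"
      by (simp add: v_def indicator_def)
    ultimately show "solvable01 ?X ?E"
      using W solves[OF v] unfolding solvable01_def by auto
  qed
qed

lemma ilp_instance_system_e:
  assumes "\<forall>s\<in>set cs. vars_below k s"
  shows "ilp_instance (unknowns_e (slots cs), []) (system_e k cs, [])"
proof -
  let ?\<sigma> = "\<lambda>x. the (map_of [] x) :: atom"
  have "fv (system_e k cs) = {}"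
    by (simp add: system_e_def fv_equations_c assms)
  moreover have "is_set (val (unknowns_e (slots cs)) ?\<sigma>)" "is_set (val (system_e k cs) ?\<sigma>)"
    by (simp_all add: unknowns_e_def system_e_def)
  moreover have "equation_over (val (unknowns_e (slots cs)) ?\<sigma>) q"
    if q: "q \<in> elts (val (system_e k cs) ?\<sigma>)" for q
  proof -
    obtain ts ys n \<rho> where s: "(ts, ys, n) \<in> set cs" and
      "q = hpair (hfun (val (unknowns_e (slots cs)) ?\<sigma>) (indicator (el ` instances ts ys \<rho>))) (hint (int n))"
      using q unfolding elts_system_e[OF assms] by auto
    moreover have "definable (hfun (val (unknowns_e (slots cs)) ?\<sigma>) (indicator (el ` instances ts ys \<rho>)))"
      using val_indicator_e[symmetric] assms s unfolding definable_def hfun_def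
      by (metis is_set_mk_set)
    ultimately show ?thesis unfolding equation_over_def by blast
  qed
  ultimately show ?thesis by (auto simp: ilp_instance_def)
qed

section \<open>Clauses as constraints\<close>

type_synonym 'r literal = "bool \<times> 'r \<times> avar list"
type_synonym 'r clause = "'r literal list"

definition lit_true :: "('r \<Rightarrow> atom list \<Rightarrow> bool) \<Rightarrow> (avar \<Rightarrow> atom) \<Rightarrow> 'r literal \<Rightarrow> bool" where
  "lit_true M \<rho> = (\<lambda>(b, r, w). M r (map \<rho> w) = b)"

definition clause_true :: "('r \<Rightarrow> atom list \<Rightarrow> bool) \<Rightarrow> 'r clause \<Rightarrow> bool" where
  "clause_true M C \<longleftrightarrow> (\<forall>\<rho>. \<exists>l\<in>set C. lit_true M \<rho> l)"

text \<open>\<open>Rel False r\<close> is the complement of the relation \<open>Rel True r\<close>, and \<open>Pick C l\<close> marks the instances of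
  the clause \<open>C\<close> that are witnessed by the literal \<open>l\<close>. The unknowns \<open>Slack C l\<close> turn the implication from
  \<open>Pick C l\<close> to \<open>l\<close> into an equation.\<close>

datatype 'r ix = Rel bool 'r | Pick "'r clause" "'r literal" | Slack "'r clause" "'r literal"

instance ix :: (countable) countable
  by countable_datatype

text \<open>All sums are 1. The first constraint picks one literal per instance of the clause; the
  sum of the complement of a literal, its pick and its slack lets a literal be picked only if it is
  true; the last kind makes \<open>Rel False r\<close> the complement of
  \<open>Rel True r\<close>.\<close>

definition clause_constraints :: "nat \<Rightarrow> 'r clause \<Rightarrow> 'r ix constraint list" where
  "clause_constraints k C = (map (\<lambda>l. (Pick C l, [0..<k])) C, [], 1) #
    concat (map (\<lambda>(b, r, w).
      [([(Rel (\<not> b) r, w), (Pick C (b, r, w), [0..<k]), (Slack C (b, r, w), [0..<k])], [], 1),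
       ([(Rel True r, [0..<length w]), (Rel False r, [0..<length w])], [], 1)]) C)"

text \<open>The bound on \<open>length w\<close> serves the complement constraint, whose variables
  are the first \<open>length w\<close> ones.\<close>

definition clause_vars_below :: "nat \<Rightarrow> 'r clause \<Rightarrow> bool" where
  "clause_vars_below k C \<longleftrightarrow> (\<forall>(b, r, w)\<in>set C. set w \<subseteq> {..<k} \<and> length w \<le> k)"

lemma vars_below_clause_constraints:
  "clause_vars_below k C \<Longrightarrow> s \<in> set (clause_constraints k C) \<Longrightarrow> vars_below k s"
  by (fastforce simp: clause_constraints_def clause_vars_below_def vars_below_def)

lemma card_1_iff_ex1: "finite A \<and> card A = 1 \<longleftrightarrow> (\<exists>!x. x \<in> A)"
proof -
  have "finite A \<and> card A = 1 \<longleftrightarrow> (\<exists>x. A = {x})"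
    by (auto simp: card_1_singleton_iff)
  then show ?thesis by auto
qed

lemma holds_1_iff: "holds W (ts, ys, 1) \<longleftrightarrow> (\<forall>\<rho>. \<exists>!x. x \<in> W \<and> x \<in> instances ts ys \<rho>)"
proof -
  from card_1_iff_ex1[of "W \<inter> _"] show ?thesis by (simp add: holds_def)
qed

lemma instances_no_binder: "instances ts [] \<rho> = (\<lambda>(i, w). (i, map \<rho> w)) ` set ts"
proof -
  have "agree_off [] \<rho> \<tau> \<longleftrightarrow> \<tau> = \<rho>" for \<tau>
    by (auto simp: agree_off_def)
  then show ?thesis by (auto simp: instances_def)
qed

definition rel_of :: "('r ix \<times> atom list) set \<Rightarrow> 'r \<Rightarrow> atom list \<Rightarrow> bool" where
  "rel_of W r us \<longleftrightarrow> (Rel True r, us) \<in> W"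

lemma clause_true_if_holds:
  assumes "\<forall>s\<in>set (clause_constraints k C). holds W s"
  shows "clause_true (rel_of W) C"
  unfolding clause_true_def
proof
  fix \<rho>
  have "holds W (map (\<lambda>l. (Pick C l, [0..<k])) C, [], 1)"
    using assms by (simp add: clause_constraints_def)
  then obtain l where l: "l \<in> set C" "(Pick C l, map \<rho> [0..<k]) \<in> W"
    unfolding holds_1_iff instances_no_binder by force
  obtain b r w where brw: "l = (b, r, w)" by (cases l)
  have "([(Rel (\<not> b) r, w), (Pick C l, [0..<k]), (Slack C l, [0..<k])], [], 1) \<in> set (clause_constraints k C)"
    "([(Rel True r, [0..<length w]), (Rel False r, [0..<length w])], [], 1) \<in> set (clause_constraints k C)"
    using l(1) by (force simp: clause_constraints_def brw)+
  then have 1: "holds W ([(Rel (\<not> b) r, w), (Pick C l, [0..<k]), (Slack C l, [0..<k])], [], 1)"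
    and 2: "holds W ([(Rel True r, [0..<length w]), (Rel False r, [0..<length w])], [], 1)"
    using assms by auto
  from 1 l(2) have neg: "(Rel (\<not> b) r, map \<rho> w) \<notin> W"
    unfolding holds_1_iff instances_no_binder by fastforce
  \<comment> \<open>The complement constraint is stated for the variables 0, 1, ...; the valuation
    sending \<open>i\<close> to entry \<open>i\<close> of the tuple instantiates it at that
    tuple.\<close>
  have nth: "map ((!) (map \<rho> w)) [0..<length w] = map \<rho> w"
    by (metis length_map map_nth)
  have "\<exists>!x. x \<in> W \<and> x \<in> {(Rel True r, map \<rho> w), (Rel False r, map \<rho> w)}"
    using 2[unfolded holds_1_iff instances_no_binder, rule_format, of "(!) (map \<rho> w)"] nth by simp
  with neg have "rel_of W r (map \<rho> w) = b"
    by (cases b) (auto simp: rel_of_def)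
  then show "\<exists>l\<in>set C. lit_true (rel_of W) \<rho> l"
    using l(1) by (auto simp: lit_true_def brw)
qed

definition pick :: "('r \<Rightarrow> atom list \<Rightarrow> bool) \<Rightarrow> 'r clause \<Rightarrow> (avar \<Rightarrow> atom) \<Rightarrow> 'r literal" where
  "pick M C \<rho> = (SOME l. l \<in> set C \<and> lit_true M \<rho> l)"

text \<open>The 0-1 assignment induced by a structure. The index tuple of a pick is read back as a
  valuation by \<open>(!) us\<close>, so the choice depends on that tuple alone.\<close>

definition expansion :: "('r \<Rightarrow> atom list \<Rightarrow> bool) \<Rightarrow> ('r ix \<times> atom list) set" where
  "expansion M = {(i, us). case i of
      Rel b r \<Rightarrow> M r us = b
    | Pick C l \<Rightarrow> pick M C ((!) us) = l
    | Slack C l \<Rightarrow> lit_true M ((!) us) l \<and> pick M C ((!) us) \<noteq> l}"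

lemma mem_expansion [simp]:
  "(Rel b r, us) \<in> expansion M \<longleftrightarrow> M r us = b"
  "(Pick C l, us) \<in> expansion M \<longleftrightarrow> pick M C ((!) us) = l"
  "(Slack C l, us) \<in> expansion M \<longleftrightarrow> lit_true M ((!) us) l \<and> pick M C ((!) us) \<noteq> l"
  by (simp_all add: expansion_def)

lemma rel_of_expansion [simp]: "rel_of (expansion M) = M"
  by (simp add: fun_eq_iff rel_of_def expansion_def)

lemma holds_expansion:
  assumes true: "clause_true M C" and below: "clause_vars_below k C"
    and s: "s \<in> set (clause_constraints k C)"
  shows "holds (expansion M) s"
proof -
  have pick: "pick M C \<rho> \<in> set C" "lit_true M \<rho> (pick M C \<rho>)" for \<rho>
  proof -
    have "\<exists>l. l \<in> set C \<and> lit_true M \<rho> l"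
      using true unfolding clause_true_def by blast
    from someI_ex[OF this] show "pick M C \<rho> \<in> set C" "lit_true M \<rho> (pick M C \<rho>)"
      by (simp_all add: pick_def)
  qed
  \<comment> \<open>Reading the tuple back can alter the valuation only from \<open>k\<close> on,
    where the clause has no variables.\<close>
  have cong: "lit_true M ((!) (map \<rho> [0..<k])) l \<longleftrightarrow> lit_true M \<rho> l" if "l \<in> set C" for \<rho> l
  proof -
    obtain b r w where brw: "l = (b, r, w)" by (cases l)
    have "set w \<subseteq> {..<k}" using below that by (auto simp: clause_vars_below_def brw)
    then have "map ((!) (map \<rho> [0..<k])) w = map \<rho> w" by auto
    then show ?thesis by (simp only: lit_true_def brw prod.case)
  qed
  from s consider
      "s = (map (\<lambda>l. (Pick C l, [0..<k])) C, [], 1)"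
    | b r w where "(b, r, w) \<in> set C"
        "s = ([(Rel (\<not> b) r, w), (Pick C (b, r, w), [0..<k]), (Slack C (b, r, w), [0..<k])], [], 1)"
    | b r w where "(b, r, w) \<in> set C"
        "s = ([(Rel True r, [0..<length w]), (Rel False r, [0..<length w])], [], 1)"
    by (auto simp: clause_constraints_def)
  then show ?thesis
  proof cases
    case 1
    have "\<exists>!x. x \<in> expansion M \<and> x \<in> (\<lambda>l. (Pick C l, map \<rho> [0..<k])) ` set C" for \<rho>
      by (rule ex1I[of _ "(Pick C (pick M C ((!) (map \<rho> [0..<k]))), map \<rho> [0..<k])"])
        (use pick(1) in \<open>auto simp: expansion_def simp del: split_paired_Ex\<close>)
    then show ?thesis unfolding 1 holds_1_iff instances_no_binder by (simp add: image_image)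
  next
    case 2
    have "\<exists>!x. x \<in> expansion M \<and> x \<in> {(Rel (\<not> b) r, map \<rho> w),
        (Pick C (b, r, w), map \<rho> [0..<k]), (Slack C (b, r, w), map \<rho> [0..<k])}" (is "\<exists>!x. ?P x") for \<rho>
    proof -
      let ?picked = "pick M C ((!) (map \<rho> [0..<k])) = (b, r, w)"
      have lit: "lit_true M ((!) (map \<rho> [0..<k])) (b, r, w) \<longleftrightarrow> M r (map \<rho> w) = b"
        using cong[OF 2(1)] by (simp add: lit_true_def)
      with pick(2) have "?picked \<Longrightarrow> M r (map \<rho> w) = b" by metis
      \<comment> \<open>Three exclusive cases, one for each unknown of the sum: the literal is
        false, it is picked, or it is true without being picked.\<close>
      then consider "M r (map \<rho> w) = (\<not> b)" "\<not> ?picked" | "M r (map \<rho> w) = b" ?picked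
        | "M r (map \<rho> w) = b" "\<not> ?picked"
        by blast
      then show ?thesis
      proof cases
        case 1
        with lit show ?thesis by (intro ex1I[of ?P "(Rel (\<not> b) r, map \<rho> w)"]) auto
      next
        case 2
        with lit show ?thesis by (intro ex1I[of ?P "(Pick C (b, r, w), map \<rho> [0..<k])"]) auto
      next
        case 3
        with lit show ?thesis by (intro ex1I[of ?P "(Slack C (b, r, w), map \<rho> [0..<k])"]) auto
      qed
    qed
    then show ?thesis unfolding 2(2) holds_1_iff instances_no_binder by simp
  next
    case 3
    have "\<exists>!x. x \<in> expansion M \<and> x \<in> {(Rel True r, us), (Rel False r, us)}" for us
      by (rule ex1I[of _ "(Rel (M r us) r, us)"]) (cases "M r us"; auto)+
    then show ?thesis unfolding 3(2) holds_1_iff instances_no_binder by simp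
  qed
qed

definition horn :: "('r \<times> avar list) list \<Rightarrow> 'r \<times> avar list \<Rightarrow> 'r clause" where
  "horn body head = (True, head) # map (Pair False) body"

lemma clause_true_horn [simp]:
  "clause_true M (horn body head) \<longleftrightarrow>
    (\<forall>\<rho>. (\<forall>(r, w)\<in>set body. M r (map \<rho> w)) \<longrightarrow> M (fst head) (map \<rho> (snd head)))"
  by (fastforce simp: clause_true_def lit_true_def horn_def)

lemma clause_true_negative_unit: "clause_true M [(False, r, w)] \<longleftrightarrow> (\<forall>\<rho>. \<not> M r (map \<rho> w))"
  by (simp add: clause_true_def lit_true_def)

section \<open>A clausal interpreter for the recursive functions\<close>

primrec code :: "recf \<Rightarrow> nat" where
  "code Zero = prod_encode (0, 0)"
| "code Succ = prod_encode (1, 0)"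
| "code (Proj i) = prod_encode (2, i)"
| "code (Comp f gs) = prod_encode (3, prod_encode (code f, list_encode (map code gs)))"
| "code (PrimRec f g) = prod_encode (4, prod_encode (code f, code g))"
| "code (Mu f) = prod_encode (5, code f)"

text \<open>\<open>IsLoop [f, n, xs]\<close> says that the search for a zero of \<open>f\<close> on the arguments \<open>xs\<close> passes all numbers
  below \<open>n\<close>, and \<open>InSeg\<close> is the initial segment whose last element is the program to be run. The last
  clause is the goal: it fails if that program returns 1 on its own code, since the segment would
  have to continue.\<close>

datatype sym = IsNum nat | IsSuc | IsPair | IsCons | IsNth | IsEval | IsEvals | IsLoop | InSeg | IsLess

instance sym :: countable
  by countable_datatype

text \<open>The rules for \<open>IsPair\<close> walk along the diagonals of the Cantor pairing: the
  pair after \<open>(a, Suc b)\<close> is \<open>(Suc a, b)\<close>, and the pair after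
  \<open>(a, 0)\<close> is \<open>(0, Suc a)\<close>. Hence pairing, and with it the coding of lists
  and programs, is expressed by successor alone. \<open>IsNum\<close> reaches 5 because the tags in
  \<open>code\<close> do.\<close>

definition program :: "sym clause list" where
  "program =
    map (\<lambda>k. horn [(IsNum k, [0]), (IsSuc, [0, 1])] (IsNum (Suc k), [1])) [0..<5] @
   [horn [(IsNum 0, [0])] (IsPair, [0, 0, 0]),
    horn [(IsPair, [0, 1, 2]), (IsSuc, [3, 1]), (IsSuc, [0, 4]), (IsSuc, [2, 5])] (IsPair, [4, 3, 5]),
    horn [(IsNum 0, [0]), (IsPair, [1, 0, 2]), (IsSuc, [1, 3]), (IsSuc, [2, 4])] (IsPair, [0, 3, 4]),
    horn [(IsPair, [0, 1, 2]), (IsSuc, [2, 3])] (IsCons, [0, 1, 3]),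
    horn [(IsCons, [0, 1, 2]), (IsNum 0, [3])] (IsNth, [2, 3, 0]),
    horn [(IsCons, [0, 1, 2]), (IsNth, [1, 3, 4]), (IsSuc, [3, 5])] (IsNth, [2, 5, 4]),
    horn [(IsNum 0, [0]), (IsPair, [0, 0, 1])] (IsEval, [1, 2, 0]),
    horn [(IsNum 1, [0]), (IsNum 0, [1]), (IsPair, [0, 1, 2]), (IsCons, [3, 1, 4]), (IsSuc, [3, 5])]
      (IsEval, [2, 4, 5]),
    horn [(IsNum 2, [0]), (IsPair, [0, 1, 2]), (IsNth, [3, 1, 4])] (IsEval, [2, 3, 4]),
    horn [(IsNum 3, [0]), (IsPair, [1, 2, 3]), (IsPair, [0, 3, 4]), (IsEvals, [2, 5, 6]), (IsEval, [1, 6, 7])]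
      (IsEval, [4, 5, 7]),
    horn [(IsNum 0, [0])] (IsEvals, [0, 1, 0]),
    horn [(IsCons, [0, 1, 2]), (IsCons, [3, 4, 5]), (IsEval, [0, 6, 3]), (IsEvals, [1, 6, 4])]
      (IsEvals, [2, 6, 5]),
    horn [(IsNum 4, [0]), (IsPair, [1, 2, 3]), (IsPair, [0, 3, 4]), (IsNum 0, [5]), (IsCons, [5, 6, 7]),
      (IsEval, [1, 6, 8])] (IsEval, [4, 7, 8]),
    horn [(IsNum 4, [0]), (IsPair, [1, 2, 3]), (IsPair, [0, 3, 4]), (IsCons, [5, 6, 7]), (IsEval, [4, 7, 8]),
      (IsCons, [8, 6, 9]), (IsCons, [5, 9, 10]), (IsEval, [2, 10, 11]), (IsSuc, [5, 12]),
      (IsCons, [12, 6, 13])] (IsEval, [4, 13, 11]),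
    horn [(IsNum 0, [0])] (IsLoop, [1, 0, 2]),
    horn [(IsLoop, [0, 1, 2]), (IsCons, [1, 2, 3]), (IsSuc, [4, 5]), (IsEval, [0, 3, 5]),
      (IsSuc, [1, 6])] (IsLoop, [0, 6, 2]),
    horn [(IsNum 5, [0]), (IsPair, [0, 1, 2]), (IsLoop, [1, 3, 4]), (IsCons, [3, 4, 5]), (IsNum 0, [6]),
      (IsEval, [1, 5, 6])] (IsEval, [2, 4, 3]),
    horn [(IsSuc, [0, 1])] (IsLess, [0, 1]),
    horn [(IsLess, [0, 1]), (IsLess, [1, 2])] (IsLess, [0, 2]),
    [(False, IsLess, [0, 0])],
    horn [(IsSuc, [0, 1]), (InSeg, [1])] (InSeg, [0]),
    horn [(InSeg, [0]), (IsSuc, [0, 1]), (IsNum 0, [2]), (IsCons, [0, 2, 3]), (IsNum 1, [4]),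
      (IsEval, [0, 3, 4])] (InSeg, [1])]"


text \<open>What the fixed constraints guarantee. There is no induction, so a model may have
  elements beyond the numerals, and its relations may contain more than the derivable facts.\<close>

locale model =
  fixes M :: "sym \<Rightarrow> atom list \<Rightarrow> bool"
  assumes program: "C \<in> set program \<Longrightarrow> clause_true M C"
    and zero_ex1: "\<exists>!a. M (IsNum 0) [a]"
    and succ_ex1: "\<exists>!b. M IsSuc [a, b]"
    and pred_or_zero: "(\<exists>a. M IsSuc [a, b]) \<or> M (IsNum 0) [b]"
begin

section \<open>The clauses as rules in an arbitrary model\<close>

lemma literal_of_horn: "(\<exists>l\<in>set (horn body head). lit_true M \<rho> l) \<longleftrightarrow>
    (list_all (\<lambda>(r, w). M r (map \<rho> w)) body \<longrightarrow> M (fst head) (map \<rho> (snd head)))"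
  by (fastforce simp: horn_def lit_true_def list_all_iff)

text \<open>Giving variable \<open>i\<close> the entry \<open>i\<close> of \<open>us\<close> makes
  every clause a statement about listed elements; each rule below is obtained by listing the values
  of its variables.\<close>

lemma all_clauses: "list_all (\<lambda>C. \<exists>l\<in>set C. lit_true M ((!) us) l) program"
  using program by (auto simp: clause_true_def list_all_iff)

lemmas clauses = all_clauses[unfolded program_def literal_of_horn list_all_append list.pred_inject
    prod.case fst_conv snd_conv list.map]

lemma IsNum_step:
  assumes "k < 5" "M (IsNum k) [a]" "M IsSuc [a, b]"
  shows "M (IsNum (Suc k)) [b]"
proof -
  have "clause_true M (horn [(IsNum k, [0]), (IsSuc, [0, 1])] (IsNum (Suc k), [1]))"
    by (rule program) (use assms(1) in \<open>auto simp: program_def\<close>)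
  then show ?thesis
    using assms unfolding clause_true_def literal_of_horn by (auto dest: spec[of _ "(!) [a, b]"])
qed

lemma IsPair_0: "M (IsNum 0) [a] \<Longrightarrow> M IsPair [a, a, a]"
  using clauses[of "[a]"] by simp

lemma IsPair_Suc_left: "M IsPair [a, b', c] \<Longrightarrow> M IsSuc [b, b'] \<Longrightarrow> M IsSuc [a, a'] \<Longrightarrow>
    M IsSuc [c, c'] \<Longrightarrow> M IsPair [a', b, c']"
  using clauses[of "[a, b', c, b, a', c']"] by simp

lemma IsPair_0_left: "M (IsNum 0) [z] \<Longrightarrow> M IsPair [a, z, c] \<Longrightarrow> M IsSuc [a, a'] \<Longrightarrow>
    M IsSuc [c, c'] \<Longrightarrow> M IsPair [z, a', c']"
  using clauses[of "[z, a, c, a', c']"] by simp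

lemma IsCons: "M IsPair [x, l, c] \<Longrightarrow> M IsSuc [c, m] \<Longrightarrow> M IsCons [x, l, m]"
  using clauses[of "[x, l, c, m]"] by simp

lemma IsNth_0: "M IsCons [x, l, m] \<Longrightarrow> M (IsNum 0) [z] \<Longrightarrow> M IsNth [m, z, x]"
  using clauses[of "[x, l, m, z]"] by simp

lemma IsNth_Suc: "M IsCons [x, l, m] \<Longrightarrow> M IsNth [l, i, y] \<Longrightarrow> M IsSuc [i, i'] \<Longrightarrow> M IsNth [m, i', y]"
  using clauses[of "[x, l, m, i, y, i']"] by simp

lemma IsEval_Zero: "M (IsNum 0) [t] \<Longrightarrow> M IsPair [t, t, e] \<Longrightarrow> M IsEval [e, xs, t]"
  using clauses[of "[t, e, xs]"] by simp

lemma IsEval_Succ: "M (IsNum 1) [t] \<Longrightarrow> M (IsNum 0) [z] \<Longrightarrow> M IsPair [t, z, e] \<Longrightarrow>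
    M IsCons [x, z, l] \<Longrightarrow> M IsSuc [x, y] \<Longrightarrow> M IsEval [e, l, y]"
  using clauses[of "[t, z, e, x, l, y]"] by simp

lemma IsEval_Proj: "M (IsNum 2) [t] \<Longrightarrow> M IsPair [t, i, e] \<Longrightarrow> M IsNth [xs, i, y] \<Longrightarrow> M IsEval [e, xs, y]"
  using clauses[of "[t, i, e, xs, y]"] by simp

lemma IsEval_Comp: "M (IsNum 3) [t] \<Longrightarrow> M IsPair [f, gs, u] \<Longrightarrow> M IsPair [t, u, e] \<Longrightarrow>
    M IsEvals [gs, xs, ys] \<Longrightarrow> M IsEval [f, ys, z] \<Longrightarrow> M IsEval [e, xs, z]"
  using clauses[of "[t, f, gs, u, e, xs, ys, z]"] by simp

lemma IsEvals_Nil: "M (IsNum 0) [z] \<Longrightarrow> M IsEvals [z, xs, z]"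
  using clauses[of "[z, xs]"] by simp

lemma IsEvals_Cons: "M IsCons [g, gs, gs'] \<Longrightarrow> M IsCons [y, ys, ys'] \<Longrightarrow> M IsEval [g, xs, y] \<Longrightarrow>
    M IsEvals [gs, xs, ys] \<Longrightarrow> M IsEvals [gs', xs, ys']"
  using clauses[of "[g, gs, gs', y, ys, ys', xs]"] by simp

lemma IsEval_PrimRec_0: "M (IsNum 4) [t] \<Longrightarrow> M IsPair [f, g, u] \<Longrightarrow> M IsPair [t, u, e] \<Longrightarrow>
    M (IsNum 0) [z] \<Longrightarrow> M IsCons [z, xs, l] \<Longrightarrow> M IsEval [f, xs, y] \<Longrightarrow> M IsEval [e, l, y]"
  using clauses[of "[t, f, g, u, e, z, xs, l, y]"] by simp

lemma IsEval_PrimRec_Suc: "M (IsNum 4) [t] \<Longrightarrow> M IsPair [f, g, u] \<Longrightarrow> M IsPair [t, u, e] \<Longrightarrow>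
    M IsCons [n, xs, l] \<Longrightarrow> M IsEval [e, l, y] \<Longrightarrow> M IsCons [y, xs, l1] \<Longrightarrow> M IsCons [n, l1, l2] \<Longrightarrow>
    M IsEval [g, l2, w] \<Longrightarrow> M IsSuc [n, n'] \<Longrightarrow> M IsCons [n', xs, l'] \<Longrightarrow> M IsEval [e, l', w]"
  using clauses[of "[t, f, g, u, e, n, xs, l, y, l1, l2, w, n', l']"] by simp

lemma IsLoop_0: "M (IsNum 0) [z] \<Longrightarrow> M IsLoop [f, z, xs]"
  using clauses[of "[z, f, xs]"] by simp

lemma IsLoop_Suc: "M IsLoop [f, n, xs] \<Longrightarrow> M IsCons [n, xs, l] \<Longrightarrow> M IsSuc [y, y'] \<Longrightarrow>
    M IsEval [f, l, y'] \<Longrightarrow> M IsSuc [n, n'] \<Longrightarrow> M IsLoop [f, n', xs]"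
  using clauses[of "[f, n, xs, l, y, y', n']"] by simp

lemma IsEval_Mu: "M (IsNum 5) [t] \<Longrightarrow> M IsPair [t, f, e] \<Longrightarrow> M IsLoop [f, n, xs] \<Longrightarrow>
    M IsCons [n, xs, l] \<Longrightarrow> M (IsNum 0) [z] \<Longrightarrow> M IsEval [f, l, z] \<Longrightarrow> M IsEval [e, xs, n]"
  using clauses[of "[t, f, e, n, xs, l, z]"] by simp

lemma IsLess_Suc: "M IsSuc [a, b] \<Longrightarrow> M IsLess [a, b]"
  using clauses[of "[a, b]"] by simp

lemma IsLess_trans: "M IsLess [a, b] \<Longrightarrow> M IsLess [b, c] \<Longrightarrow> M IsLess [a, c]"
  using clauses[of "[a, b, c]"] by simp

lemma IsLess_irrefl: "\<not> M IsLess [a, a]"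
  using clauses[of "[a]"] by (simp add: lit_true_def)

lemma InSeg_Suc: "M IsSuc [a, b] \<Longrightarrow> M InSeg [b] \<Longrightarrow> M InSeg [a]"
  using clauses[of "[a, b]"] by simp

lemma InSeg_last: "M InSeg [a] \<Longrightarrow> M IsSuc [a, b] \<Longrightarrow> M (IsNum 0) [z] \<Longrightarrow> M IsCons [a, z, l] \<Longrightarrow>
    M (IsNum 1) [y] \<Longrightarrow> M IsEval [a, l, y] \<Longrightarrow> M InSeg [b]"
  using clauses[of "[a, b, z, l, y]"] by simp

section \<open>Numerals and evaluation in an arbitrary model\<close>

primrec num :: "nat \<Rightarrow> atom" where
  "num 0 = (THE a. M (IsNum 0) [a])"
| "num (Suc n) = (THE b. M IsSuc [num n, b])"

lemma IsNum_0_num: "M (IsNum 0) [num 0]"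
  using theI'[OF zero_ex1] by simp

lemma IsSuc_num: "M IsSuc [num n, num (Suc n)]"
  using theI'[OF succ_ex1] by simp

lemma IsNum_num: "k \<le> 5 \<Longrightarrow> M (IsNum k) [num k]"
proof (induction k)
  case 0
  show ?case by (rule IsNum_0_num)
next
  case (Suc k)
  then show ?case using IsNum_step[OF _ _ IsSuc_num] by simp
qed

text \<open>Induction on the code, that is, along the Cantor enumeration of pairs.\<close>

lemma IsPair_num: "M IsPair [num a, num b, num (prod_encode (a, b))]"
proof (induction "prod_encode (a, b)" arbitrary: a b)
  case 0
  then have "a = 0" "b = 0"
    using le_prod_encode_1[of a b] le_prod_encode_2[of b a] by simp_all
  then show ?case using IsPair_0[OF IsNum_0_num] by (simp add: prod_encode_def)
next
  case (Suc c)
  show ?case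
  proof (cases a)
    case (Suc a')
    have eq: "prod_encode (a, b) = Suc (prod_encode (a', Suc b))"
      by (simp add: Suc prod_encode_def)
    have "M IsPair [num a', num (Suc b), num (prod_encode (a', Suc b))]"
      using Suc.hyps(1)[of a' "Suc b"] Suc.hyps(2) eq by simp
    then show ?thesis
      unfolding eq unfolding Suc by (rule IsPair_Suc_left[OF _ IsSuc_num IsSuc_num IsSuc_num])
  next
    case 0
    with Suc.hyps(2) obtain b' where b: "b = Suc b'"
      by (cases b) (simp_all add: prod_encode_def)
    have eq: "prod_encode (a, b) = Suc (prod_encode (b', 0))"
      by (simp add: 0 b prod_encode_def)
    have "M IsPair [num b', num 0, num (prod_encode (b', 0))]"
      using Suc.hyps(1)[of b' 0] Suc.hyps(2) eq by simp
    then show ?thesis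
      unfolding eq unfolding 0 b by (rule IsPair_0_left[OF IsNum_0_num _ IsSuc_num IsSuc_num])
  qed
qed

lemma IsCons_num: "M IsCons [num x, num (list_encode xs), num (list_encode (x # xs))]"
  unfolding list_encode.simps by (rule IsCons[OF IsPair_num IsSuc_num])

lemma IsNth_num: "i < length xs \<Longrightarrow> M IsNth [num (list_encode xs), num i, num (xs ! i)]"
proof (induction xs arbitrary: i)
  case (Cons x xs)
  show ?case
  proof (cases i)
    case 0
    then show ?thesis using IsNth_0[OF IsCons_num IsNum_0_num] by (simp del: num.simps list_encode.simps)
  next
    case (Suc j)
    then have "M IsNth [num (list_encode xs), num j, num (xs ! j)]"
      using Cons by simp
    from IsNth_Suc[OF IsCons_num this IsSuc_num] show ?thesis
      by (simp add: Suc del: num.simps list_encode.simps)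
  qed
qed simp

lemma list_encode_Nil: "list_encode [] = 0"
  by simp

text \<open>Each rule of the semantics is mirrored by a clause, so a halting computation is
  derivable in every model. The converse is shown for the least model only, by
  \<open>eval_sound\<close>.\<close>

lemma IsEval_num: "computes p xs y \<Longrightarrow> M IsEval [num (code p), num (list_encode xs), num y]"
proof (induction rule: computes.induct)
  case (Zero xs)
  show ?case unfolding code.simps by (rule IsEval_Zero[OF IsNum_0_num IsPair_num])
next
  case (Succ x)
  show ?case unfolding code.simps
    by (rule IsEval_Succ[OF IsNum_num IsNum_0_num IsPair_num IsCons_num[of _ "[]", unfolded list_encode_Nil] IsSuc_num]) simp
next
  case (Proj i xs)
  then show ?case unfolding code.simps by (intro IsEval_Proj[OF IsNum_num IsPair_num] IsNth_num) simp
next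
  case (Comp xs gs ys f z)
  from Comp.IH(1) have
    "M IsEvals [num (list_encode (map code gs)), num (list_encode xs), num (list_encode ys)]"
  proof (induction rule: list_all2_induct)
    case Nil
    show ?case unfolding list.map list_encode_Nil by (rule IsEvals_Nil[OF IsNum_0_num])
  next
    case (Cons g gs y ys)
    then show ?case unfolding list.map by (intro IsEvals_Cons[OF IsCons_num IsCons_num]) simp_all
  qed
  from IsEval_Comp[OF IsNum_num IsPair_num IsPair_num this Comp.IH(2)] show ?case
    unfolding code.simps by simp
next
  case (PrimRec_0 f xs y g)
  show ?case unfolding code.simps
    by (rule IsEval_PrimRec_0[OF IsNum_num IsPair_num IsPair_num IsNum_0_num IsCons_num PrimRec_0.IH]) simp
next
  case (PrimRec_Suc f g n xs y z)
  show ?case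
    using IsEval_PrimRec_Suc[OF IsNum_num IsPair_num IsPair_num IsCons_num
        PrimRec_Suc.IH(1)[unfolded code.simps] IsCons_num IsCons_num PrimRec_Suc.IH(2) IsSuc_num IsCons_num]
    unfolding code.simps by simp
next
  case (Mu f n xs)
  have "k \<le> n \<Longrightarrow> M IsLoop [num (code f), num k, num (list_encode xs)]" for k
  proof (induction k)
    case 0
    show ?case by (rule IsLoop_0[OF IsNum_0_num])
  next
    case (Suc k)
    then obtain y where "M IsEval [num (code f), num (list_encode (k # xs)), num (Suc y)]"
      using Mu.IH(2)[of k] by auto
    with Suc show ?case by (intro IsLoop_Suc[OF _ IsCons_num IsSuc_num _ IsSuc_num]) simp_all
  qed
  then show ?case unfolding code.simps
    by (intro IsEval_Mu[OF IsNum_num IsPair_num _ IsCons_num IsNum_0_num Mu.IH(1)]) simp_all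
qed

lemma IsLess_num: "i < j \<Longrightarrow> M IsLess [num i, num j]"
proof (induction j)
  case (Suc j)
  have "M IsLess [num j, num (Suc j)]" by (rule IsLess_Suc[OF IsSuc_num])
  with Suc show ?case using IsLess_trans by (cases "i = j") (simp_all del: num.simps)
qed simp

text \<open>Distinct numerals are related by \<open>IsLess\<close>, which is irreflexive.\<close>

lemma inj_num: "inj num"
  by (rule injI) (metis IsLess_num IsLess_irrefl linorder_neqE_nat)

text \<open>An element outside the range of \<open>num\<close> would start an infinite descent along predecessors inside
  the finite segment, which the order \<open>IsLess\<close> keeps from closing up to a cycle.\<close>

lemma segment:
  assumes fin: "finite {a. M InSeg [a]}" and card: "card {a. M InSeg [a]} = Suc n"
  shows "M InSeg [num n]" "\<not> M InSeg [num (Suc n)]"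
proof -
  let ?A = "{a. M InSeg [a]}"
  have "?A \<subseteq> range num"
  proof (rule ccontr)
    assume "\<not> ?A \<subseteq> range num"
    then have "?A - range num \<noteq> {}" by blast
    moreover have "asymp_on (?A - range num) (\<lambda>a b. M IsLess [a, b])"
      using IsLess_trans IsLess_irrefl by (blast intro: asymp_onI)
    moreover have "transp_on (?A - range num) (\<lambda>a b. M IsLess [a, b])"
      using IsLess_trans by (blast intro: transp_onI)
    ultimately obtain m where m: "m \<in> ?A - range num" and
      min: "\<forall>a\<in>?A - range num. a \<noteq> m \<longrightarrow> \<not> M IsLess [a, m]"
      using Finite_Set.bex_min_element[of "?A - range num"] fin by blast
    have "m \<noteq> num 0" using m by blast
    then have "\<not> M (IsNum 0) [m]"
      using zero_ex1 IsNum_0_num by (metis (no_types))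
    with pred_or_zero[of m] obtain a where a: "M IsSuc [a, m]" by blast
    have less: "M IsLess [a, m]" using a by (rule IsLess_Suc)
    then have "a \<noteq> m" using IsLess_irrefl[of m] by metis
    moreover have "a \<in> ?A" using InSeg_Suc[OF a] m by simp
    ultimately obtain i where "a = num i" using min less by blast
    then have "m = num (Suc i)"
      using a succ_ex1[of a] IsSuc_num[of i] by (metis (no_types))
    with m show False by blast
  qed
  then have A: "?A = num ` {i. M InSeg [num i]}" by blast
  then have I: "finite {i. M InSeg [num i]}" "card {i. M InSeg [num i]} = Suc n"
    using fin card finite_imageD[of num "{i. M InSeg [num i]}"] card_image[of num "{i. M InSeg [num i]}"]
      inj_on_subset[OF inj_num subset_UNIV] by metis+
  \<comment> \<open>The indices of the segment are closed downwards, and a downward closed set of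
    \<open>Suc n\<close> natural numbers consists of 0, ..., \<open>n\<close>.\<close>
  have down: "M InSeg [num i]" if "M InSeg [num j]" "i \<le> j" for i j
  proof (rule inc_induct[OF that(2)])
    show "M InSeg [num j]" by (rule that(1))
    show "M InSeg [num k]" if "M InSeg [num (Suc k)]" for k
      using InSeg_Suc[OF IsSuc_num that] .
  qed
  show "M InSeg [num n]"
  proof (rule ccontr)
    assume "\<not> M InSeg [num n]"
    then have "i < n" if "M InSeg [num i]" for i
      using down[OF that, of n] by (cases "i < n") simp_all
    then have "{i. M InSeg [num i]} \<subseteq> {..<n}" by blast
    from card_mono[OF _ this] I(2) show False by simp
  qed
  show "\<not> M InSeg [num (Suc n)]"
  proof
    assume "M InSeg [num (Suc n)]"
    then have "{..Suc n} \<subseteq> {i. M InSeg [num i]}" using down by blast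
    from card_mono[OF I(1) this] I(2) show False by simp
  qed
qed

text \<open>By the size of the segment its last numeral is \<open>code p\<close>; a derived result 1
  would put the next numeral into it.\<close>

lemma not_computes_1:
  assumes "finite {a. M InSeg [a]}" "card {a. M InSeg [a]} = Suc (code p)"
  shows "\<not> computes p [code p] 1"
proof
  assume "computes p [code p] 1"
  then have "M IsEval [num (code p), num (list_encode [code p]), num 1]" by (rule IsEval_num)
  moreover have "M IsCons [num (code p), num 0, num (list_encode [code p])]"
    using IsCons_num[of _ "[]"] by simp
  ultimately have "M InSeg [num (Suc (code p))]"
    by (intro InSeg_last[OF segment(1)[OF assms] IsSuc_num IsNum_0_num _ IsNum_num]) simp_all
  with segment(2)[OF assms] show False by blast
qed

end

section \<open>The least model over the natural numbers\<close>

abbreviation cons_code :: "nat \<Rightarrow> nat \<Rightarrow> nat" where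
  "cons_code x l \<equiv> Suc (prod_encode (x, l))"

text \<open>The least relations closed under the evaluation rules. They range over all numbers,
  since the clauses apply to numbers that code no program as well.\<close>

inductive eval :: "nat \<Rightarrow> nat \<Rightarrow> nat \<Rightarrow> bool"
  and evals :: "nat \<Rightarrow> nat \<Rightarrow> nat \<Rightarrow> bool"
  and loop :: "nat \<Rightarrow> nat \<Rightarrow> nat \<Rightarrow> bool" where
  eval_Zero: "eval (prod_encode (0, 0)) l 0"
| eval_Succ: "eval (prod_encode (1, 0)) (cons_code x 0) (Suc x)"
| eval_Proj: "i < length (list_decode l) \<Longrightarrow> eval (prod_encode (2, i)) l (list_decode l ! i)"
| eval_Comp: "evals gs l ys \<Longrightarrow> eval f ys z \<Longrightarrow> eval (prod_encode (3, prod_encode (f, gs))) l z"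
| evals_Nil: "evals 0 l 0"
| evals_Cons: "eval g l y \<Longrightarrow> evals gs l ys \<Longrightarrow> evals (cons_code g gs) l (cons_code y ys)"
| eval_PrimRec_0: "eval f l y \<Longrightarrow> eval (prod_encode (4, prod_encode (f, g))) (cons_code 0 l) y"
| eval_PrimRec_Suc: "eval (prod_encode (4, prod_encode (f, g))) (cons_code n l) y \<Longrightarrow>
    eval g (cons_code n (cons_code y l)) z \<Longrightarrow>
    eval (prod_encode (4, prod_encode (f, g))) (cons_code (Suc n) l) z"
| loop_0: "loop f 0 l"
| loop_Suc: "loop f n l \<Longrightarrow> eval f (cons_code n l) (Suc y) \<Longrightarrow> loop f (Suc n) l"
| eval_Mu: "loop f n l \<Longrightarrow> eval f (cons_code n l) 0 \<Longrightarrow> eval (prod_encode (5, f)) l n"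

lemma list_decode_cons_code [simp]: "list_decode (cons_code x l) = x # list_decode l"
  by simp

text \<open>Simultaneous induction over derivations, for all programs with the given code: comparing
  tags fixes the outermost constructor, and the hypotheses treat the subprograms.\<close>

lemma eval_sound:
  "eval e l y \<Longrightarrow> \<forall>p. e = code p \<longrightarrow> computes p (list_decode l) y"
  "evals gs l ys \<Longrightarrow> \<forall>ps. gs = list_encode (map code ps) \<longrightarrow>
    list_all2 (\<lambda>p. computes p (list_decode l)) ps (list_decode ys)"
  "loop f n l \<Longrightarrow> \<forall>p. f = code p \<longrightarrow> (\<forall>m<n. \<exists>y. computes p (m # list_decode l) (Suc y))"
proof (induction rule: eval_evals_loop.inducts)
  case (eval_Zero l)
  have "p = Zero" if "prod_encode (0, 0) = code p" for p
    using that by (cases p) simp_all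
  then show ?case by (auto intro: computes.Zero)
next
  case (eval_Succ x)
  have "p = Succ" if "prod_encode (1, 0) = code p" for p
    using that by (cases p) simp_all
  then show ?case by (auto intro: computes.Succ)
next
  case (eval_Proj i l)
  have "p = Proj i" if "prod_encode (2, i) = code p" for p
    using that by (cases p) simp_all
  with eval_Proj show ?case by (auto intro: computes.Proj)
next
  case (eval_Comp gs l ys f z)
  show ?case
  proof (intro allI impI)
    fix p assume "prod_encode (3, prod_encode (f, gs)) = code p"
    then obtain f' gs' where "p = Comp f' gs'" "f = code f'" "gs = list_encode (map code gs')"
      by (cases p) simp_all
    then show "computes p (list_decode l) z"
      using eval_Comp.IH by (auto intro: computes.Comp)
  qed
next
  case (evals_Nil l)
  show ?case
  proof (intro allI impI)
    fix ps assume "0 = list_encode (map code ps)"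
    then show "list_all2 (\<lambda>p. computes p (list_decode l)) ps (list_decode 0)" by (cases ps) simp_all
  qed
next
  case (evals_Cons g l y gs ys)
  show ?case
  proof (intro allI impI)
    fix ps assume "cons_code g gs = list_encode (map code ps)"
    then obtain p ps' where "ps = p # ps'" "g = code p" "gs = list_encode (map code ps')"
      by (cases ps) simp_all
    then show "list_all2 (\<lambda>p. computes p (list_decode l)) ps (list_decode (cons_code y ys))"
      using evals_Cons.IH by simp
  qed
next
  case (eval_PrimRec_0 f l y g)
  show ?case
  proof (intro allI impI)
    fix p assume "prod_encode (4, prod_encode (f, g)) = code p"
    then obtain f' g' where "p = PrimRec f' g'" "f = code f'" by (cases p) simp_all
    then show "computes p (list_decode (cons_code 0 l)) y"
      using eval_PrimRec_0.IH by (auto intro: computes.PrimRec_0)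
  qed
next
  case (eval_PrimRec_Suc f g n l y z)
  show ?case
  proof (intro allI impI)
    fix p assume p: "prod_encode (4, prod_encode (f, g)) = code p"
    then obtain f' g' where "p = PrimRec f' g'" "g = code g'" by (cases p) simp_all
    moreover have "computes p (n # list_decode l) y"
      using eval_PrimRec_Suc.IH(1) p by simp
    ultimately show "computes p (list_decode (cons_code (Suc n) l)) z"
      using eval_PrimRec_Suc.IH(2) by (auto intro: computes.PrimRec_Suc)
  qed
next
  case (loop_0 f l)
  show ?case by simp
next
  case (loop_Suc f n l y)
  then show ?case by (fastforce simp: less_Suc_eq)
next
  case (eval_Mu f n l)
  show ?case
  proof (intro allI impI)
    fix p assume "prod_encode (5, f) = code p"
    then obtain f' where "p = Mu f'" "f = code f'" by (cases p) simp_all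
    then show "computes p (list_decode l) n"
      using eval_Mu.IH by (auto intro: computes.Mu)
  qed
qed

primrec standard :: "nat \<Rightarrow> sym \<Rightarrow> atom list \<Rightarrow> bool" where
  "standard n (IsNum k) us \<longleftrightarrow> us ! 0 = k"
| "standard n IsSuc us \<longleftrightarrow> us ! 1 = Suc (us ! 0)"
| "standard n IsPair us \<longleftrightarrow> us ! 2 = prod_encode (us ! 0, us ! 1)"
| "standard n IsCons us \<longleftrightarrow> us ! 2 = cons_code (us ! 0) (us ! 1)"
| "standard n IsNth us \<longleftrightarrow>
    us ! 1 < length (list_decode (us ! 0)) \<and> us ! 2 = list_decode (us ! 0) ! (us ! 1)"
| "standard n IsEval us \<longleftrightarrow> eval (us ! 0) (us ! 1) (us ! 2)"
| "standard n IsEvals us \<longleftrightarrow> evals (us ! 0) (us ! 1) (us ! 2)"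
| "standard n IsLoop us \<longleftrightarrow> loop (us ! 0) (us ! 1) (us ! 2)"
| "standard n InSeg us \<longleftrightarrow> us ! 0 \<le> n"
| "standard n IsLess us \<longleftrightarrow> us ! 0 < us ! 1"

text \<open>The rules hold by the introduction rules and the recursion of Cantor pairing. The
  assumption enters in the last clause: for an element \<open>a\<close> of the segment,
  \<open>Suc a\<close> stays at most \<open>n\<close> unless \<open>a = n\<close>, and that case is
  excluded.\<close>

lemma standard_model:
  assumes "\<not> eval n (list_encode [n]) 1" and "C \<in> set program"
  shows "clause_true (standard n) C"
proof -
  have pair: "prod_encode (0, 0) = 0" "prod_encode (Suc a, b) = Suc (prod_encode (a, Suc b))"
    "prod_encode (0, Suc a) = Suc (prod_encode (a, 0))" for a b
    by (simp_all add: prod_encode_def)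
  have "\<forall>C\<in>set program. clause_true (standard n) C"
    unfolding program_def set_append list.set ball_Un ball_simps
    using assms(1)
    by (intro conjI; simp add: clause_true_negative_unit;
        (blast intro: eval_evals_loop.intros eval_Succ[unfolded One_nat_def] pair pair(2,3)[symmetric])?)
      (auto intro: eval_PrimRec_Suc loop_Suc eval_Mu simp: Suc_le_eq le_less)
  with assms(2) show ?thesis by blast
qed

section \<open>Computability of the encoding\<close>

definition computable :: "(nat \<Rightarrow> nat) \<Rightarrow> bool" where
  "computable f \<longleftrightarrow> (\<exists>p. \<forall>x. computes p [x] (f x))"

definition computable2 :: "(nat \<Rightarrow> nat \<Rightarrow> nat) \<Rightarrow> bool" where
  "computable2 f \<longleftrightarrow> (\<exists>p. \<forall>x y. computes p [x, y] (f x y))"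

text \<open>Stated for argument lists of any length because recursion without parameters runs its
  base case on the empty list.\<close>

lemma computes_const: "\<exists>p. \<forall>xs. computes p xs c"
proof (induction c)
  case 0
  show ?case using computes.Zero by blast
next
  case (Suc c)
  then obtain p where p: "\<And>xs. computes p xs c" by blast
  have "computes (Comp Succ [p]) xs (Suc c)" for xs
    by (rule computes.Comp[of _ _ "[c]"]) (simp_all add: p computes.Succ)
  then show ?case by blast
qed

section \<open>Closure properties of computable functions\<close>

lemma computable_id: "computable (\<lambda>x. x)"
  unfolding computable_def using computes.Proj[of 0 "[_]"] by auto

lemma computable_const: "computable (\<lambda>x. c)"
  unfolding computable_def using computes_const by blast

lemma computable_comp:
  assumes "computable f" "computable g"
  shows "computable (\<lambda>x. f (g x))"
proof -
  obtain p q where p: "\<And>x. computes p [x] (f x)" and q: "\<And>x. computes q [x] (g x)"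
    using assms unfolding computable_def by blast
  have "computes (Comp p [q]) [x] (f (g x))" for x
    by (rule computes.Comp[of _ _ "[g x]"]) (simp_all add: p q)
  then show ?thesis unfolding computable_def by blast
qed

lemma computable2_comp:
  assumes "computable2 f" "computable g" "computable h"
  shows "computable (\<lambda>x. f (g x) (h x))"
proof -
  obtain p q r where p: "\<And>x y. computes p [x, y] (f x y)" and q: "\<And>x. computes q [x] (g x)"
    and r: "\<And>x. computes r [x] (h x)"
    using assms unfolding computable_def computable2_def by blast
  have "computes (Comp p [q, r]) [x] (f (g x) (h x))" for x
    by (rule computes.Comp[of _ _ "[g x, h x]"]) (simp_all add: p q r)
  then show ?thesis unfolding computable_def by blast
qed

lemma computable_Suc: "computable Suc"
  unfolding computable_def using computes.Succ by blast

lemma computable_rec: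
  assumes "computable2 g"
  shows "computable (rec_nat c g)"
proof -
  obtain p q where p: "\<And>x y. computes p [x, y] (g x y)" and q: "\<And>xs. computes q xs c"
    using assms computes_const unfolding computable2_def by blast
  have "computes (PrimRec q p) [n] (rec_nat c g n)" for n
    by (induction n) (auto intro: computes.PrimRec_0 computes.PrimRec_Suc p q)
  then show ?thesis unfolding computable_def by blast
qed

lemma computable2_snd:
  assumes "computable f"
  shows "computable2 (\<lambda>x y. f y)"
proof -
  obtain p where p: "\<And>x. computes p [x] (f x)"
    using assms unfolding computable_def by blast
  have "computes (Comp p [Proj 1]) [x, y] (f y)" for x y
    by (rule computes.Comp[of _ _ "[y]"]) (use computes.Proj[of 1 "[x, y]"] in \<open>simp_all add: p\<close>)
  then show ?thesis unfolding computable2_def by blast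
qed

lemma computable_funpow:
  assumes "computable f"
  shows "computable (\<lambda>n. (f ^^ n) c)"
proof -
  have "(f ^^ n) c = rec_nat c (\<lambda>_. f) n" for n
    by (induction n) simp_all
  then show ?thesis using computable_rec[OF computable2_snd[OF assms]] by simp
qed

lemma computes_add: "\<exists>p. \<forall>x y. computes p [x, y] (x + y)"
proof -
  have step: "computes (Comp Succ [Proj 1]) [x, z, y] (Suc z)" for x y z
    by (rule computes.Comp[of _ _ "[z]"])
      (use computes.Proj[of 1 "[x, z, y]"] in \<open>simp_all add: computes.Succ\<close>)
  have "computes (PrimRec (Proj 0) (Comp Succ [Proj 1])) [x, y] (x + y)" for x y
    by (induction x)
      (use computes.Proj[of 0 "[y]"] step in \<open>auto intro: computes.PrimRec_0 computes.PrimRec_Suc\<close>)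
  then show ?thesis by blast
qed

lemma computable2_add: "computable2 (+)"
  unfolding computable2_def using computes_add .

lemma computable2_comp2:
  assumes "computable2 f" "computable2 g" "computable2 h"
  shows "computable2 (\<lambda>x y. f (g x y) (h x y))"
proof -
  obtain p q r where p: "\<And>x y. computes p [x, y] (f x y)" and q: "\<And>x y. computes q [x, y] (g x y)"
    and r: "\<And>x y. computes r [x, y] (h x y)"
    using assms unfolding computable2_def by metis
  have "computes (Comp p [q, r]) [x, y] (f (g x y) (h x y))" for x y
    by (rule computes.Comp[of _ _ "[g x y, h x y]"]) (simp_all add: p q r)
  then show ?thesis unfolding computable2_def by blast
qed

lemma computable2_fst: "computable2 (\<lambda>x y. x)"
  unfolding computable2_def using computes.Proj[of 0 "[_, _]"] by fastforce

lemma computable_comp_computable2: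
  assumes "computable f" "computable2 g"
  shows "computable2 (\<lambda>x y. f (g x y))"
  using computable2_comp2[OF computable2_snd[OF assms(1)] assms(2) assms(2)] .

lemma computable_triangle: "computable triangle"
proof -
  have "computable (rec_nat 0 (\<lambda>n y. y + Suc n))"
    by (intro computable_rec computable2_comp2[OF computable2_add] computable2_snd computable_id
        computable_comp_computable2[OF computable_Suc] computable2_fst)
  moreover have "rec_nat 0 (\<lambda>n y. y + Suc n) n = triangle n" for n
    by (induction n) simp_all
  ultimately show ?thesis by (metis (no_types) ext)
qed

lemma computable_prod_encode:
  assumes "computable f" "computable g"
  shows "computable (\<lambda>x. prod_encode (f x, g x))"
  unfolding prod_encode_def
  using assms by (simp add: computable2_comp[OF computable2_add] computable_comp[OF computable_triangle])

lemma computable_list_encode_Cons: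
  assumes "computable f" "computable (\<lambda>x. list_encode (g x))"
  shows "computable (\<lambda>x. list_encode (f x # g x))"
  using computable_comp[OF computable_Suc computable_prod_encode[OF assms]] by simp

lemmas computable_intros = computable_prod_encode computable_list_encode_Cons computable_const

section \<open>Encodings of the varying expressions\<close>

lemma computable_enc_pair_e:
  assumes "computable (\<lambda>n. enc_expr (f n))" "computable (\<lambda>n. enc_expr (g n))"
  shows "computable (\<lambda>n. enc_expr (pair_e (f n) (g n)))"
  unfolding pair_e_def enc_expr.simps enc_compr.simps list.map
  by (intro computable_intros assms)

text \<open>A successor wraps the numeral in one more singleton. On encodings this is a fixed
  computable map, so the encoding of \<open>hnat_e n\<close> is its \<open>n\<close>-fold
  iterate.\<close>

lemma computable_enc_hnat_e: "computable (\<lambda>n. enc_expr (hnat_e n))"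
proof -
  let ?f = "\<lambda>x. prod_encode (1, list_encode [prod_encode (x, prod_encode (list_encode [], enc_fm TT))])"
  have "enc_expr (hnat_e n) = (?f ^^ n) (enc_expr (Union []))" for n
    by (induction n) simp_all
  moreover have "computable ?f"
    by (intro computable_intros computable_id)
  ultimately show ?thesis using computable_funpow by simp
qed

text \<open>The parameter enters only through the right-hand side of the first constraint; the rest
  of the encoding is constant.\<close>

lemma computable_enc_system_e:
  assumes "\<And>m n. slots ((ts, ys, m) # cs) = slots ((ts, ys, n) # cs)" 
  shows "computable (\<lambda>n. enc_pres (system_e k ((ts, ys, Suc n) # cs), []))"
proof -
  have hnat: "computable (\<lambda>n. enc_expr (hnat_e (Suc n)))"
    using computable_comp[OF computable_enc_hnat_e computable_Suc] .
  \<comment> \<open>Setting the count to 0 inside \<open>slots\<close> makes the list of slots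
    visibly independent of \<open>n\<close>.\<close>
  have "system_e k ((ts, ys, Suc n) # cs) =
    Union (equations_c k (slots ((ts, ys, 0) # cs)) (ts, ys, Suc n) #
      map (equations_c k (slots ((ts, ys, 0) # cs))) cs)" for n
    by (simp add: system_e_def slots_def)
  then show ?thesis
    unfolding equations_c_def prod.case int_e_def enc_pres.simps enc_expr.simps enc_compr.simps list.map
    by (simp only: enc_expr.simps enc_compr.simps list.map)
      (intro computable_intros computable_enc_pair_e hnat)
qed

section \<open>Undecidability\<close>

text \<open>In order: there is exactly one zero, the successor is a total function, and each element
  either is zero or has exactly one predecessor. The bound 14 fits \<open>program\<close>, whose
  largest variable is 13.\<close>

definition fixed_constraints :: "sym ix constraint list" where
  "fixed_constraints =
    ([(Rel True (IsNum 0), [0])], [0], 1) #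
    ([(Rel True IsSuc, [0, 1])], [1], 1) #
    ([(Rel True IsSuc, [0, 1]), (Rel True (IsNum 0), [1])], [0], 1) #
    concat (map (clause_constraints 14) program)"

definition constraints :: "nat \<Rightarrow> sym ix constraint list" where
  "constraints n = ([(Rel True InSeg, [0])], [0], Suc n) # fixed_constraints"

lemma program_vars_below: "C \<in> set program \<Longrightarrow> clause_vars_below 14 C"
  by (auto simp: program_def horn_def clause_vars_below_def)

lemma constraints_vars_below: "\<forall>s\<in>set (constraints n). vars_below 14 s"
  using vars_below_clause_constraints[OF program_vars_below]
  by (auto simp: constraints_def fixed_constraints_def vars_below_def)

section \<open>Meaning of the constraints and existence of solutions\<close>

lemma instances_one_binder:
  "instances ts [y] \<rho> = (\<Union>a. (\<lambda>(i, w). (i, map (\<rho>(y := a)) w)) ` set ts)"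
proof -
  have "agree_off [y] \<rho> \<tau> \<longleftrightarrow> (\<exists>a. \<tau> = \<rho>(y := a))" for \<tau>
  proof
    assume "agree_off [y] \<rho> \<tau>"
    then have "\<tau> = \<rho>(y := \<tau> y)" by (auto simp: agree_off_def)
    then show "\<exists>a. \<tau> = \<rho>(y := a)" ..
  qed (auto simp: agree_off_def)
  then show ?thesis by (fastforce simp: instances_def)
qed

lemma holds_segment:
  "holds W ([(Rel True InSeg, [0])], [0], n) \<longleftrightarrow>
    finite {a. rel_of W InSeg [a]} \<and> card {a. rel_of W InSeg [a]} = n"
proof -
  let ?f = "\<lambda>a. (Rel True InSeg, [a])"
  have "W \<inter> instances [(Rel True InSeg, [0])] [0] \<rho> = ?f ` {a. rel_of W InSeg [a]}" for \<rho>
    by (auto simp: instances_one_binder rel_of_def)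
  moreover have inj: "inj_on ?f A" for A
    by (rule inj_onI) simp
  ultimately show ?thesis
    by (simp add: holds_def card_image[OF inj] finite_image_iff[OF inj])
qed

lemma holds_zero:
  "holds W ([(Rel True r, [0])], [0], 1) \<longleftrightarrow> (\<exists>!a. rel_of W r [a])"
  unfolding holds_1_iff instances_one_binder rel_of_def by auto

lemma holds_function:
  "holds W ([(Rel True r, [0, 1])], [1], 1) \<longleftrightarrow> (\<forall>a. \<exists>!b. rel_of W r [a, b])"
proof -
  have "(\<exists>!x. x \<in> W \<and> x \<in> instances [(Rel True r, [0, 1])] [1] \<rho>) \<longleftrightarrow> (\<exists>!b. rel_of W r [\<rho> 0, b])" for \<rho>
    unfolding instances_one_binder rel_of_def by auto
  moreover have "(\<forall>\<rho>. P (\<rho> 0)) \<longleftrightarrow> (\<forall>a. P a)" for P :: "nat \<Rightarrow> bool"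
    by (auto dest: spec[of _ "\<lambda>_. _"])
  ultimately show ?thesis unfolding holds_1_iff by simp
qed

lemma model_if_holds:
  assumes "\<forall>s\<in>set fixed_constraints. holds W s"
  shows "model (rel_of W)"
proof
  fix C assume "C \<in> set program"
  then have "\<forall>s\<in>set (clause_constraints 14 C). holds W s"
    using assms by (auto simp: fixed_constraints_def)
  then show "clause_true (rel_of W) C" by (rule clause_true_if_holds)
next
  show "\<exists>!a. rel_of W (IsNum 0) [a]"
    using assms by (simp add: fixed_constraints_def holds_zero del: One_nat_def)
next
  fix a show "\<exists>!b. rel_of W IsSuc [a, b]"
    using assms by (simp add: fixed_constraints_def holds_function del: One_nat_def)
next
  fix b
  have "holds W ([(Rel True IsSuc, [0, 1]), (Rel True (IsNum 0), [1])], [0], 1)"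
    using assms by (simp add: fixed_constraints_def)
  \<comment> \<open>The constant valuation gives variable 1, the only parameter, the value
    \<open>b\<close>.\<close>
  then have "\<exists>x. x \<in> W \<and> x \<in> instances [(Rel True IsSuc, [0, 1]), (Rel True (IsNum 0), [1])] [0] (\<lambda>_. b)"
    unfolding holds_1_iff by blast
  then show "(\<exists>a. rel_of W IsSuc [a, b]) \<or> rel_of W (IsNum 0) [b]"
    by (auto simp: instances_one_binder rel_of_def)
qed

lemma holds_standard:
  assumes "\<not> eval n (list_encode [n]) 1" and "s \<in> set (constraints n)"
  shows "holds (expansion (standard n)) s"
proof -
  let ?W = "expansion (standard n)"
  from assms(2) consider "s = ([(Rel True InSeg, [0])], [0], Suc n)"
    | "s = ([(Rel True (IsNum 0), [0])], [0], 1)"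
    | "s = ([(Rel True IsSuc, [0, 1])], [1], 1)"
    | "s = ([(Rel True IsSuc, [0, 1]), (Rel True (IsNum 0), [1])], [0], 1)"
    | C where "C \<in> set program" "s \<in> set (clause_constraints 14 C)"
    by (auto simp: constraints_def fixed_constraints_def)
  then show ?thesis
  proof cases
    case 1
    have "{a. a \<le> n} = {..n}" by auto
    then show ?thesis by (simp add: 1 holds_segment)
  next
    case 2
    then show ?thesis by (simp add: holds_zero del: One_nat_def)
  next
    case 3
    then show ?thesis by (simp only: holds_function rel_of_expansion standard.simps) simp
  next
    case 4
    \<comment> \<open>The single unknown of value 1 is the zero test if the number is 0, and
      otherwise the pair with its predecessor.\<close>
    have "\<exists>!x. x \<in> ?W \<and> x \<in> instances [(Rel True IsSuc, [0, 1]), (Rel True (IsNum 0), [1])] [0] \<rho>"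
      for \<rho>
      by (rule ex1I[of _ "if \<rho> 1 = 0 then (Rel True (IsNum 0), [\<rho> 1]) else (Rel True IsSuc, [\<rho> 1 - 1, \<rho> 1])"])
        (auto simp: instances_one_binder)
    then show ?thesis unfolding 4 holds_1_iff by blast
  next
    case 5
    then show ?thesis
      using holds_expansion[OF standard_model[OF assms(1)]] program_vars_below by blast
  qed
qed

text \<open>By \<open>slots_constraints\<close> every count gives the same unknowns; 0 is a
  representative.\<close>

definition unknowns :: presentation where
  "unknowns = (unknowns_e (slots (constraints 0)), [])"

definition equations :: "nat \<Rightarrow> presentation" where
  "equations n = (system_e 14 (constraints n), [])"

lemma slots_constraints: "slots (constraints n) = slots (constraints 0)"
  by (simp add: constraints_def slots_def)

lemma ilp_instance_program: "ilp_instance unknowns (equations n)"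
  using ilp_instance_system_e[OF constraints_vars_below, of n]
  by (simp add: unknowns_def equations_def slots_constraints[of n])

lemma solvable01_iff_not_computes:
  "solvable01 (pres_val unknowns) (pres_val (equations (code p))) \<longleftrightarrow> \<not> computes p [code p] 1"
proof -
  let ?n = "code p"
  have "solvable01 (pres_val unknowns) (pres_val (equations ?n)) \<longleftrightarrow>
      (\<exists>W. \<forall>s\<in>set (constraints ?n). holds W s)"
    using solvable01_system_e[OF constraints_vars_below, of ?n]
    by (simp add: unknowns_def equations_def slots_constraints[of ?n])
  also have "\<dots> \<longleftrightarrow> \<not> computes p [code p] 1"
  proof
    assume "\<exists>W. \<forall>s\<in>set (constraints ?n). holds W s"
    then obtain W where W: "\<forall>s\<in>set (constraints ?n). holds W s" ..
    then have "model (rel_of W)" by (intro model_if_holds) (simp add: constraints_def)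
    moreover have "holds W ([(Rel True InSeg, [0])], [0], Suc ?n)"
      using W by (simp add: constraints_def)
    ultimately show "\<not> computes p [code p] 1"
      unfolding holds_segment using model.not_computes_1[of "rel_of W" p] by simp
  next
    assume "\<not> computes p [code p] 1"
    then have "\<not> eval ?n (list_encode [?n]) 1"
      using eval_sound(1)[of ?n "list_encode [?n]" 1] by (auto simp del: list_encode.simps)
    then show "\<exists>W. \<forall>s\<in>set (constraints ?n). holds W s"
      using holds_standard by blast
  qed
  finally show ?thesis .
qed

lemma computable_enc_instance: "computable (\<lambda>n. enc_instance unknowns (equations n))"
  unfolding enc_instance_def equations_def constraints_def
  by (intro computable_prod_encode computable_const computable_enc_system_e) (simp add: slots_def)

theorem theorem3p14:
  shows "\<not> (\<exists>p. decides p ilp_instance (\<lambda>P Q. solvable01 (pres_val P) (pres_val Q)))"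
proof
  assume "\<exists>p. decides p ilp_instance (\<lambda>P Q. solvable01 (pres_val P) (pres_val Q))"
  then obtain p where p: "decides p ilp_instance (\<lambda>P Q. solvable01 (pres_val P) (pres_val Q))" ..
  obtain s where s: "\<And>n. computes s [n] (enc_instance unknowns (equations n))"
    using computable_enc_instance unfolding computable_def by blast
  \<comment> \<open>Run on its own code, \<open>?d\<close> decides whether the system asserting that
    \<open>?d\<close> does not return 1 there is solvable.\<close>
  let ?d = "Comp p [s]"
  let ?yes = "solvable01 (pres_val unknowns) (pres_val (equations (code ?d)))"
  have "computes p [enc_instance unknowns (equations (code ?d))] (if ?yes then 1 else 0)"
    using p ilp_instance_program unfolding decides_def by blast
  then have d: "computes ?d [code ?d] (if ?yes then 1 else 0)"
    by (intro computes.Comp[of _ _ "[enc_instance unknowns (equations (code ?d))]"]) (simp_all add: s)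
  \<comment> \<open>The answer 1 contradicts solvability of the system. With the answer 0 the system
    is unsolvable, so \<open>?d\<close> would also return 1, against determinism.\<close>
  show False
    using d computes_det[OF d, of 1] solvable01_iff_not_computes[of ?d] by (cases ?yes) simp_all
qed

end
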